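(* Let $\mathbb{H}$ and $\mathbb{K}$ be complex Hilbert spaces, and let $A$ be a bounded linear operator on $\mathbb{H}$ and $B$ a bounded linear operator on $\mathbb{K}$. Then $$w^2(A \otimes B) \leq \frac{1}{2}\left\|A^*A \otimes B^*B+AA^* \otimes BB^*\right\| \leq \|A\|^2\|B\|^2.$$
   Context: For a bounded linear operator $T$ on a complex Hilbert space with inner product $\langle\cdot,\cdot\rangle$, the numerical radius is $w(T)=\sup\{|\langle Tx,x\rangle| : \|x\|=1\}$, $w^2(T)$ denotes $(w(T))^2$, and $\|T\|$ is the operator norm. $\mathbb{H}\otimes\mathbb{K}$ is the Hilbert space tensor product (the completion of the algebraic tensor product under the inner product determined by $\langle x\otimes y,z\otimes u\rangle=\langle x,z\rangle\langle y,u\rangle$), and $A\otimes B$ is the bounded linear operator on $\mathbb{H}\otimes\mathbb{K}$ determined by $(A\otimes B)(x\otimes y)=Ax\otimes By$. *)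

theory Defs
  imports "HOL-Analysis.Analysis" "HOL-Library.Poly_Mapping"
begin

section \<open>Complex Hilbert spaces\<close>

class complex_vector = real_vector +
  fixes scaleC :: "complex \<Rightarrow> 'a \<Rightarrow> 'a"  (infixr "*\<^sub>C" 75)
  assumes scaleC_add_right: "a *\<^sub>C (x + y) = a *\<^sub>C x + a *\<^sub>C y"
    and scaleC_add_left: "(a + b) *\<^sub>C x = a *\<^sub>C x + b *\<^sub>C x"
    and scaleC_scaleC: "a *\<^sub>C (b *\<^sub>C x) = (a * b) *\<^sub>C x"
    and scaleR_eq_scaleC: "r *\<^sub>R x = complex_of_real r *\<^sub>C x"
begin

lemma scaleC_one: "1 *\<^sub>C x = x"
  by (metis of_real_1 scaleR_eq_scaleC scaleR_one)

end

global_interpretation complex_vector: vector_space "scaleC :: complex \<Rightarrow> 'a \<Rightarrow> 'a::complex_vector"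
  defines csubspace = complex_vector.subspace
    and cspan = complex_vector.span
  by unfold_locales
     (simp_all add: scaleC_add_right scaleC_add_left scaleC_scaleC scaleC_one)

text \<open>
  The inner product \<open>cinner\<close> is linear in the first and conjugate-linear in the second argument.
  Every complex inner product space is a real one with inner product \<open>Re (cinner x y)\<close>; building
  on \<^class>\<open>real_inner\<close> gives the norm \<open>sqrt (cinner x x)\<close> and its metric and topology.
\<close>

class complex_inner = complex_vector + real_inner +
  fixes cinner :: "'a \<Rightarrow> 'a \<Rightarrow> complex"
  assumes cinner_commute: "cinner x y = cnj (cinner y x)"
    and cinner_add_left: "cinner (x + y) z = cinner x z + cinner y z"
    and cinner_scaleC_left: "cinner (c *\<^sub>C x) y = c * cinner x y"
    and inner_eq_Re_cinner: "inner x y = Re (cinner x y)"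

class chilbert_space = complex_inner + complete_space

instantiation complex :: chilbert_space
begin
definition "scaleC_complex (c::complex) (x::complex) = c * x"
definition "cinner_complex (x::complex) (y::complex) = x * cnj y"
instance
  by standard (auto simp: scaleC_complex_def cinner_complex_def algebra_simps
      scaleR_conv_of_real inner_complex_def)
end

lemma cinner_add_right:
  fixes x y z :: "'a::complex_inner"
  shows "cinner x (y + z) = cinner x y + cinner x z"
  by (metis cinner_commute cinner_add_left complex_cnj_add)

lemma cinner_scaleC_right:
  fixes x y :: "'a::complex_inner"
  shows "cinner x (c *\<^sub>C y) = cnj c * cinner x y"
  by (metis cinner_commute cinner_scaleC_left complex_cnj_mult)

lemma cinner_zero_left [simp]: "cinner (0::'a::complex_inner) y = 0"
  using cinner_scaleC_left[of 0 0 y] by simp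

lemma cinner_zero_right [simp]: "cinner x (0::'a::complex_inner) = 0"
  using cinner_scaleC_right[of x 0 0] by simp

lemma cinner_diff_left: "cinner (x - y) (z::'a::complex_inner) = cinner x z - cinner y z"
  using cinner_add_left[of "x - y" y z] by simp

lemma cinner_diff_right: "cinner (x::'a::complex_inner) (y - z) = cinner x y - cinner x z"
  using cinner_add_right[of x "y - z" z] by simp

lemma cinner_sum_left: "cinner (sum f A) (y::'a::complex_inner) = (\<Sum>i\<in>A. cinner (f i) y)"
  by (induction A rule: infinite_finite_induct) (simp_all add: cinner_add_left)

lemma cinner_sum_right: "cinner (x::'a::complex_inner) (sum f A) = (\<Sum>i\<in>A. cinner x (f i))"
  by (induction A rule: infinite_finite_induct) (simp_all add: cinner_add_right)

lemma cinner_self: "cinner x x = complex_of_real ((norm (x::'a::complex_inner))\<^sup>2)"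
proof -
  have "Im (cinner x x) = 0"
    using cinner_commute[of x x] by (metis Reals_cnj_iff complex_is_Real_iff)
  then show ?thesis
    by (simp add: complex_eq_iff power2_norm_eq_inner inner_eq_Re_cinner)
qed

lemma cinner_eq_zero_iff: "cinner x x = 0 \<longleftrightarrow> x = (0::'a::complex_inner)"
  by (simp add: cinner_self)

lemma norm_scaleC: "norm (c *\<^sub>C (x::'a::complex_inner)) = cmod c * norm x"
proof -
  have "complex_of_real ((norm (c *\<^sub>C x))\<^sup>2) = (c * cnj c) * cinner x x"
    unfolding cinner_self[symmetric] by (simp add: cinner_scaleC_left cinner_scaleC_right)
  then have "complex_of_real ((norm (c *\<^sub>C x))\<^sup>2) = complex_of_real ((cmod c * norm x)\<^sup>2)"
    unfolding cinner_self complex_norm_square[symmetric] of_real_mult[symmetric] power_mult_distrib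
    by simp
  then have "(norm (c *\<^sub>C x))\<^sup>2 = (cmod c * norm x)\<^sup>2"
    by (simp only: of_real_eq_iff)
  then show ?thesis
    by (simp add: power2_eq_iff_nonneg)
qed

lemma cinner_Cauchy_Schwarz: "cmod (cinner x y) \<le> norm x * norm (y::'a::complex_inner)"
proof (cases "cinner x y = 0")
  case False
  define u where "u = cnj (sgn (cinner x y))"
  have u: "cmod u = 1"
    using False by (simp add: u_def norm_sgn)
  have "u * cinner x y = complex_of_real (cmod (cinner x y))"
    using False unfolding u_def sgn_div_norm
    by (simp add: scaleR_conv_of_real field_simps complex_norm_square[symmetric] power2_eq_square)
  then have "cmod (cinner x y) = inner (u *\<^sub>C x) y"
    by (simp add: inner_eq_Re_cinner cinner_scaleC_left)
  also have "\<dots> \<le> norm (u *\<^sub>C x) * norm y"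
    by (rule norm_cauchy_schwarz)
  finally show ?thesis
    by (simp add: norm_scaleC u)
qed simp

section \<open>The algebraic tensor product\<close>

text \<open>
  Finitely supported functions with values in a complex vector space; for coefficients in
  \<^typ>\<open>complex\<close> this is the free complex vector space on \<open>'p\<close>.
\<close>

instantiation poly_mapping :: (type, complex_vector) complex_vector
begin
lift_definition scaleR_poly_mapping :: "real \<Rightarrow> ('a \<Rightarrow>\<^sub>0 'b) \<Rightarrow> ('a \<Rightarrow>\<^sub>0 'b)"
  is "\<lambda>r f k. r *\<^sub>R f k"
  by (erule rev_finite_subset) auto
lift_definition scaleC_poly_mapping :: "complex \<Rightarrow> ('a \<Rightarrow>\<^sub>0 'b) \<Rightarrow> ('a \<Rightarrow>\<^sub>0 'b)"
  is "\<lambda>c f k. c *\<^sub>C f k"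
  by (erule rev_finite_subset) auto
instance
  by standard (transfer; simp add: fun_eq_iff algebra_simps scaleC_add_right scaleC_add_left
      scaleC_scaleC scaleR_eq_scaleC)+
end

inductive_set tensor_relators ::
  "(('a::complex_vector \<times> 'b::complex_vector) \<Rightarrow>\<^sub>0 complex) set" where
  "Poly_Mapping.single (x + x', y) 1 - Poly_Mapping.single (x, y) 1
     - Poly_Mapping.single (x', y) 1 \<in> tensor_relators"
| "Poly_Mapping.single (x, y + y') 1 - Poly_Mapping.single (x, y) 1
     - Poly_Mapping.single (x, y') 1 \<in> tensor_relators"
| "Poly_Mapping.single (c *\<^sub>C x, y) 1 - c *\<^sub>C Poly_Mapping.single (x, y) 1 \<in> tensor_relators"
| "Poly_Mapping.single (x, c *\<^sub>C y) 1 - c *\<^sub>C Poly_Mapping.single (x, y) 1 \<in> tensor_relators"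

quotient_type (overloaded) ('a, 'b) algebraic_tensor =
  "('a::complex_vector \<times> 'b::complex_vector) \<Rightarrow>\<^sub>0 complex" /
  "\<lambda>f g. f - g \<in> cspan tensor_relators"
proof (rule equivpI)
  show "reflp (\<lambda>f g. f - g \<in> cspan (tensor_relators :: (('a \<times> 'b) \<Rightarrow>\<^sub>0 complex) set))"
    by (simp add: reflp_def complex_vector.span_zero)
  show "symp (\<lambda>f g. f - g \<in> cspan (tensor_relators :: (('a \<times> 'b) \<Rightarrow>\<^sub>0 complex) set))"
  proof (rule sympI)
    fix f g :: "('a \<times> 'b) \<Rightarrow>\<^sub>0 complex"
    assume "f - g \<in> cspan tensor_relators"
    then have "- (f - g) \<in> cspan tensor_relators" by (rule complex_vector.span_neg)
    then show "g - f \<in> cspan tensor_relators" by simp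
  qed
  show "transp (\<lambda>f g. f - g \<in> cspan (tensor_relators :: (('a \<times> 'b) \<Rightarrow>\<^sub>0 complex) set))"
  proof (rule transpI)
    fix f g h :: "('a \<times> 'b) \<Rightarrow>\<^sub>0 complex"
    assume "f - g \<in> cspan tensor_relators" "g - h \<in> cspan tensor_relators"
    then have "(f - g) + (g - h) \<in> cspan tensor_relators" by (rule complex_vector.span_add)
    then show "f - h \<in> cspan tensor_relators" by simp
  qed
qed

lemma diff_diff_diff: "(a - c) - (b - d) = (a - b) - (c - (d::'a::ab_group_add))"
  by (simp add: algebra_simps)

instantiation algebraic_tensor :: (complex_vector, complex_vector) complex_vector
begin

lift_definition zero_algebraic_tensor :: "('a, 'b) algebraic_tensor" is 0 .

lift_definition plus_algebraic_tensor ::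
  "('a, 'b) algebraic_tensor \<Rightarrow> ('a, 'b) algebraic_tensor \<Rightarrow> ('a, 'b) algebraic_tensor" is "(+)"
  unfolding add_diff_add by (rule complex_vector.span_add)

lift_definition uminus_algebraic_tensor ::
  "('a, 'b) algebraic_tensor \<Rightarrow> ('a, 'b) algebraic_tensor" is uminus
  unfolding minus_diff_minus by (rule complex_vector.span_neg)

lift_definition minus_algebraic_tensor ::
  "('a, 'b) algebraic_tensor \<Rightarrow> ('a, 'b) algebraic_tensor \<Rightarrow> ('a, 'b) algebraic_tensor" is "(-)"
  by (subst diff_diff_diff) (rule complex_vector.span_diff)

lift_definition scaleC_algebraic_tensor ::
  "complex \<Rightarrow> ('a, 'b) algebraic_tensor \<Rightarrow> ('a, 'b) algebraic_tensor" is "scaleC"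
  unfolding complex_vector.scale_right_diff_distrib[symmetric] by (rule complex_vector.span_scale)

definition scaleR_algebraic_tensor ::
  "real \<Rightarrow> ('a, 'b) algebraic_tensor \<Rightarrow> ('a, 'b) algebraic_tensor"
  where "scaleR_algebraic_tensor r t = complex_of_real r *\<^sub>C t"

instance
proof
  fix s t u :: "('a, 'b) algebraic_tensor" and a b :: complex and r q :: real
  show "s + t + u = s + (t + u)"
    by transfer (simp add: complex_vector.span_zero add.assoc)
  show "s + t = t + s"
    by transfer (simp add: complex_vector.span_zero add.commute)
  show "0 + t = t"
    by transfer (simp add: complex_vector.span_zero)
  show "- t + t = 0"
    by transfer (simp add: complex_vector.span_zero)
  show "s - t = s + - t"
    by transfer (simp add: complex_vector.span_zero)
  show add_right: "a *\<^sub>C (s + t) = a *\<^sub>C s + a *\<^sub>C t"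
    for a and s t :: "('a, 'b) algebraic_tensor"
    by transfer (simp add: complex_vector.span_zero scaleC_add_right)
  show add_left: "(a + b) *\<^sub>C t = a *\<^sub>C t + b *\<^sub>C t"
    for a b and t :: "('a, 'b) algebraic_tensor"
    by transfer (simp add: complex_vector.span_zero scaleC_add_left)
  show scale: "a *\<^sub>C b *\<^sub>C t = (a * b) *\<^sub>C t"
    for a b and t :: "('a, 'b) algebraic_tensor"
    by transfer (simp add: complex_vector.span_zero scaleC_scaleC)
  show "r *\<^sub>R t = complex_of_real r *\<^sub>C t"
    by (simp add: scaleR_algebraic_tensor_def)
  show "r *\<^sub>R (s + t) = r *\<^sub>R s + r *\<^sub>R t"
    unfolding scaleR_algebraic_tensor_def by (rule add_right)
  show "(r + q) *\<^sub>R t = r *\<^sub>R t + q *\<^sub>R t"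
    unfolding scaleR_algebraic_tensor_def of_real_add by (rule add_left)
  show "r *\<^sub>R q *\<^sub>R t = (r * q) *\<^sub>R t"
    unfolding scaleR_algebraic_tensor_def of_real_mult by (rule scale)
  show "1 *\<^sub>R t = t"
    unfolding scaleR_algebraic_tensor_def of_real_1
    by transfer (simp add: complex_vector.span_zero scaleC_one)
qed

end

lift_definition atensor ::
  "'a::complex_vector \<Rightarrow> 'b::complex_vector \<Rightarrow> ('a, 'b) algebraic_tensor"
  is "\<lambda>x y. Poly_Mapping.single (x, y) 1" .

lemma atensor_add_left: "atensor (x + x') y = atensor x y + atensor x' y"
  by transfer (unfold diff_diff_eq[symmetric], rule complex_vector.span_base[OF tensor_relators.intros(1)])

lemma atensor_add_right: "atensor x (y + y') = atensor x y + atensor x y'"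
  by transfer (unfold diff_diff_eq[symmetric], rule complex_vector.span_base[OF tensor_relators.intros(2)])

lemma atensor_scaleC_left: "atensor (c *\<^sub>C x) y = c *\<^sub>C atensor x y"
  by transfer (rule complex_vector.span_base[OF tensor_relators.intros(3)])

lemma atensor_scaleC_right: "atensor x (c *\<^sub>C y) = c *\<^sub>C atensor x y"
  by transfer (rule complex_vector.span_base[OF tensor_relators.intros(4)])

lemma atensor_zero_left [simp]: "atensor 0 y = 0"
  using atensor_scaleC_left[of 0 0 y] by simp

lemma atensor_zero_right [simp]: "atensor x 0 = 0"
  using atensor_scaleC_right[of x 0 0] by simp

lemma atensor_sum_right: "atensor x (sum f A) = (\<Sum>i\<in>A. atensor x (f i))"
  by (induction A rule: infinite_finite_induct) (simp_all add: atensor_add_right)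

lemma free_induct [case_names zero add]:
  fixes f :: "'p \<Rightarrow>\<^sub>0 complex"
  assumes "P 0" and "\<And>f c p. P f \<Longrightarrow> P (f + c *\<^sub>C Poly_Mapping.single p 1)"
  shows "P f"
proof (induction "card (Poly_Mapping.keys f)" arbitrary: f)
  case 0
  then have "Poly_Mapping.keys f = {}" by (metis card_0_eq finite_keys)
  then have "f = 0" by (intro poly_mapping_eqI) (metis empty_iff in_keys_iff lookup_zero)
  then show ?case using assms(1) by simp
next
  case (Suc n)
  then have "Poly_Mapping.keys f \<noteq> {}" by (metis card.empty nat.distinct(1))
  then obtain p where p: "p \<in> Poly_Mapping.keys f" by blast
  define g where "g = f - Poly_Mapping.lookup f p *\<^sub>C Poly_Mapping.single p 1"
  have "Poly_Mapping.lookup g k = (if k = p then 0 else Poly_Mapping.lookup f k)" for k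
    by (simp add: g_def lookup_minus scaleC_poly_mapping.rep_eq lookup_single scaleC_complex_def)
  then have "Poly_Mapping.keys g = Poly_Mapping.keys f - {p}"
    by (auto simp: in_keys_iff split: if_splits)
  then have "P g"
    using Suc(2) p by (intro Suc(1)) (simp add: card_Diff_singleton Suc(2)[symmetric])
  then show ?case
    using assms(2)[of g "Poly_Mapping.lookup f p" p] by (simp add: g_def)
qed

lemma algebraic_tensor_induct [case_names zero add]:
  fixes t :: "('a::complex_vector, 'b::complex_vector) algebraic_tensor"
  assumes "P 0" and "\<And>t x y. P t \<Longrightarrow> P (t + atensor x y)"
  shows "P t"
proof -
  have "P (abs_algebraic_tensor f)" for f
  proof (induction f rule: free_induct)
    case zero
    then show ?case using assms(1) by (simp add: zero_algebraic_tensor_def)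
  next
    case (add f c p)
    have "abs_algebraic_tensor (f + c *\<^sub>C Poly_Mapping.single p 1)
        = abs_algebraic_tensor f + atensor (c *\<^sub>C fst p) (snd p)"
      unfolding atensor_scaleC_left
      by (simp add: atensor.abs_eq scaleC_algebraic_tensor.abs_eq plus_algebraic_tensor.abs_eq)
    then show ?case using assms(2)[OF add] by simp
  qed
  then show ?thesis
    by (rule algebraic_tensor.abs_induct)
qed

subsection \<open>Its inner product\<close>

definition free_extend :: "('p \<Rightarrow> complex) \<Rightarrow> ('p \<Rightarrow>\<^sub>0 complex) \<Rightarrow> complex"
  where "free_extend g f = (\<Sum>p\<in>Poly_Mapping.keys f. Poly_Mapping.lookup f p * g p)"

lemma free_extend_alt:
  assumes "finite S" "Poly_Mapping.keys f \<subseteq> S"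
  shows "free_extend g f = (\<Sum>p\<in>S. Poly_Mapping.lookup f p * g p)"
  unfolding free_extend_def using assms by (intro sum.mono_neutral_left) (auto simp: in_keys_iff)

lemma free_extend_add: "free_extend g (f + h) = free_extend g f + free_extend g h"
proof -
  let ?S = "Poly_Mapping.keys f \<union> Poly_Mapping.keys h"
  have "finite ?S" "Poly_Mapping.keys (f + h) \<subseteq> ?S"
    by (simp_all add: Poly_Mapping.keys_add)
  then show ?thesis
    by (simp add: free_extend_alt[of ?S] lookup_add sum.distrib distrib_right)
qed

lemma free_extend_scaleC: "free_extend g (c *\<^sub>C f) = c * free_extend g f"
proof -
  have "Poly_Mapping.keys (c *\<^sub>C f) \<subseteq> Poly_Mapping.keys f"
    by (auto simp: in_keys_iff scaleC_poly_mapping.rep_eq)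
  then show ?thesis
    by (simp add: free_extend_alt[of "Poly_Mapping.keys f"] scaleC_poly_mapping.rep_eq
        scaleC_complex_def sum_distrib_left mult.assoc)
qed

lemma free_extend_zero [simp]: "free_extend g 0 = 0"
  by (simp add: free_extend_def)

lemma free_extend_diff: "free_extend g (f - h) = free_extend g f - free_extend g h"
  using free_extend_add[of g "f - h" h] by simp

lemma free_extend_single [simp]: "free_extend g (Poly_Mapping.single p 1) = g p"
  by (simp add: free_extend_def)

lemma free_extend_relators:
  assumes "\<And>x x' y. g (x + x', y) = g (x, y) + g (x', y)"
    and "\<And>x y y'. g (x, y + y') = g (x, y) + g (x, y')"
    and "\<And>c x y. g (c *\<^sub>C x, y) = c * g (x, y)"
    and "\<And>c x y. g (x, c *\<^sub>C y) = c * g (x, y)"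
    and f: "f \<in> cspan tensor_relators"
  shows "free_extend g f = 0"
proof -
  have "csubspace {f. free_extend g f = 0}"
    by (rule complex_vector.subspaceI) (simp_all add: free_extend_add free_extend_scaleC)
  moreover have "tensor_relators \<subseteq> {f. free_extend g f = 0}"
    by (auto elim!: tensor_relators.cases simp: free_extend_diff free_extend_scaleC assms(1-4))
  ultimately have "cspan tensor_relators \<subseteq> {f. free_extend g f = 0}"
    by (intro complex_vector.span_minimal)
  then show ?thesis using f by blast
qed

text \<open>The sesquilinear extension of \<open>\<langle>x \<otimes> y, z \<otimes> u\<rangle> = \<langle>x, z\<rangle> \<langle>y, u\<rangle>\<close>.\<close>

definition free_cinner ::
  "(('a::complex_inner \<times> 'b::complex_inner) \<Rightarrow>\<^sub>0 complex) \<Rightarrow> (('a \<times> 'b) \<Rightarrow>\<^sub>0 complex) \<Rightarrow> complex"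
  where "free_cinner f h =
    (\<Sum>p\<in>Poly_Mapping.keys f. \<Sum>q\<in>Poly_Mapping.keys h.
       Poly_Mapping.lookup f p * cnj (Poly_Mapping.lookup h q) *
       (cinner (fst p) (fst q) * cinner (snd p) (snd q)))"

lemma free_cinner_commute: "free_cinner f h = cnj (free_cinner h f)"
proof -
  have *: "cinner x y = cnj (cinner y x)" for x y :: "'c::complex_inner"
    by (rule cinner_commute)
  have "cnj (free_cinner h f) =
    (\<Sum>q\<in>Poly_Mapping.keys h. \<Sum>p\<in>Poly_Mapping.keys f.
       Poly_Mapping.lookup f p * cnj (Poly_Mapping.lookup h q) *
       (cinner (fst p) (fst q) * cinner (snd p) (snd q)))"
    unfolding free_cinner_def cnj_sum complex_cnj_mult complex_cnj_cnj
    by (simp add: *[symmetric] mult_ac)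
  then show ?thesis
    unfolding free_cinner_def by (subst sum.swap) simp
qed

lemma free_cinner_extend_left:
  "free_cinner f h = free_extend (\<lambda>p. free_cinner (Poly_Mapping.single p 1) h) f"
  by (simp add: free_cinner_def free_extend_def sum_distrib_left mult_ac)

lemma free_cinner_extend_right:
  "free_cinner (Poly_Mapping.single p 1) h =
    cnj (free_extend (\<lambda>q. cinner (fst q) (fst p) * cinner (snd q) (snd p)) h)"
  by (subst free_cinner_commute) (simp add: free_cinner_def free_extend_def mult_ac)

lemma free_cinner_relators_left:
  assumes "f \<in> cspan tensor_relators"
  shows "free_cinner f h = 0"
proof (subst free_cinner_extend_left, rule free_extend_relators[OF _ _ _ _ assms])
  have *: "free_cinner (Poly_Mapping.single (x, y) 1) h =
      (\<Sum>q\<in>Poly_Mapping.keys h. cnj (Poly_Mapping.lookup h q) * (cinner x (fst q) * cinner y (snd q)))"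
    for x y
    by (simp add: free_cinner_def)
  show "free_cinner (Poly_Mapping.single (x + x', y) 1) h =
      free_cinner (Poly_Mapping.single (x, y) 1) h + free_cinner (Poly_Mapping.single (x', y) 1) h"
    for x x' y
    by (simp add: * cinner_add_left sum.distrib[symmetric] algebra_simps)
  show "free_cinner (Poly_Mapping.single (x, y + y') 1) h =
      free_cinner (Poly_Mapping.single (x, y) 1) h + free_cinner (Poly_Mapping.single (x, y') 1) h"
    for x y y'
    by (simp add: * cinner_add_left sum.distrib[symmetric] algebra_simps)
  show "free_cinner (Poly_Mapping.single (c *\<^sub>C x, y) 1) h =
      c * free_cinner (Poly_Mapping.single (x, y) 1) h" for c x y
    by (simp add: * cinner_scaleC_left sum_distrib_left mult_ac)
  show "free_cinner (Poly_Mapping.single (x, c *\<^sub>C y) 1) h =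
      c * free_cinner (Poly_Mapping.single (x, y) 1) h" for c x y
    by (simp add: * cinner_scaleC_left sum_distrib_left mult_ac)
qed

lemma free_cinner_diff_left: "free_cinner (f - g) h = free_cinner f h - free_cinner g h"
  by (subst (1 2 3) free_cinner_extend_left) (rule free_extend_diff)

lemma free_cinner_add_left: "free_cinner (f + g) h = free_cinner f h + free_cinner g h"
  by (subst (1 2 3) free_cinner_extend_left) (rule free_extend_add)

lemma free_cinner_scaleC_left: "free_cinner (c *\<^sub>C f) h = c * free_cinner f h"
  by (subst (1 2) free_cinner_extend_left) (rule free_extend_scaleC)

lift_definition atensor_cinner ::
  "('a::complex_inner, 'b::complex_inner) algebraic_tensor \<Rightarrow> ('a, 'b) algebraic_tensor \<Rightarrow> complex"
  is free_cinner
proof -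
  fix f f' h h' :: "('a \<times> 'b) \<Rightarrow>\<^sub>0 complex"
  assume "f - f' \<in> cspan tensor_relators" "h - h' \<in> cspan tensor_relators"
  then have "free_cinner f h = free_cinner f' h" "free_cinner h f' = free_cinner h' f'"
    using free_cinner_relators_left[of "f - f'" h] free_cinner_relators_left[of "h - h'" f']
    by (simp_all add: free_cinner_diff_left)
  then show "free_cinner f h = free_cinner f' h'"
    by (metis free_cinner_commute)
qed

lemma atensor_cinner_commute: "atensor_cinner s t = cnj (atensor_cinner t s)"
  by transfer (rule free_cinner_commute)

lemma atensor_cinner_add_left: "atensor_cinner (s + t) u = atensor_cinner s u + atensor_cinner t u"
  by transfer (rule free_cinner_add_left)

lemma atensor_cinner_scaleC_left: "atensor_cinner (c *\<^sub>C s) t = c * atensor_cinner s t"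
  by transfer (rule free_cinner_scaleC_left)

lemma atensor_cinner_add_right: "atensor_cinner s (t + u) = atensor_cinner s t + atensor_cinner s u"
  by (metis atensor_cinner_commute atensor_cinner_add_left complex_cnj_add)

lemma atensor_cinner_atensor:
  "atensor_cinner (atensor x y) (atensor z u) = cinner x z * cinner y u"
  by transfer (simp add: free_cinner_def)

lemma atensor_cinner_zero [simp]: "atensor_cinner 0 t = 0" "atensor_cinner t 0 = 0"
  using atensor_cinner_scaleC_left[of 0 0 t] atensor_cinner_commute[of t 0] by simp_all

lemma atensor_cinner_sum_left: "atensor_cinner (sum f A) t = (\<Sum>i\<in>A. atensor_cinner (f i) t)"
  by (induction A rule: infinite_finite_induct) (simp_all add: atensor_cinner_add_left)

lemma atensor_cinner_sum_right: "atensor_cinner t (sum f A) = (\<Sum>i\<in>A. atensor_cinner t (f i))"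
  by (induction A rule: infinite_finite_induct) (simp_all add: atensor_cinner_add_right)

lemma algebraic_tensor_orthogonal_form:
  fixes t :: "('a::complex_vector, 'b::complex_inner) algebraic_tensor"
  shows "\<exists>E X. finite E \<and> 0 \<notin> E \<and> (\<forall>e\<in>E. \<forall>e'\<in>E. e \<noteq> e' \<longrightarrow> cinner e e' = 0)
    \<and> t = (\<Sum>e\<in>E. atensor (X e) e)"
proof (induction t rule: algebraic_tensor_induct)
  case zero
  show ?case by (rule exI[of _ "{}"]) simp
next
  case (add t x y)
  then obtain E X where E: "finite E" "0 \<notin> E"
    and orth: "\<And>e e'. e \<in> E \<Longrightarrow> e' \<in> E \<Longrightarrow> e \<noteq> e' \<Longrightarrow> cinner e e' = 0"
    and t: "t = (\<Sum>e\<in>E. atensor (X e) e)"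
    by blast
  define c where "c e = cinner y e / cinner e e" for e
  define r where "r = y - (\<Sum>e\<in>E. c e *\<^sub>C e)"
  have r: "cinner r e = 0" if e: "e \<in> E" for e
  proof -
    have "(\<Sum>e'\<in>E. c e' * cinner e' e) = (\<Sum>e'\<in>E. if e' = e then c e * cinner e e else 0)"
      using orth e by (intro sum.cong) auto
    also have "\<dots> = cinner y e"
      using E e by (auto simp: c_def cinner_eq_zero_iff)
    finally show ?thesis
      by (simp add: r_def cinner_diff_left cinner_sum_left cinner_scaleC_left)
  qed
  define X' where "X' e = X e + c e *\<^sub>C x" for e
  have "atensor x y = (\<Sum>e\<in>E. atensor (c e *\<^sub>C x) e) + atensor x r"
  proof -
    have "y = (\<Sum>e\<in>E. c e *\<^sub>C e) + r" by (simp add: r_def)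
    then have "atensor x y = atensor x ((\<Sum>e\<in>E. c e *\<^sub>C e) + r)" by simp
    then show ?thesis
      by (simp add: atensor_add_right atensor_sum_right atensor_scaleC_right atensor_scaleC_left)
  qed
  then have tx: "t + atensor x y = (\<Sum>e\<in>E. atensor (X' e) e) + atensor x r"
    by (simp add: t X'_def atensor_add_left sum.distrib)
  show ?case
  proof (cases "r = 0")
    case True
    then show ?thesis
      using E orth tx by (intro exI[of _ E] exI[of _ X']) auto
  next
    case False
    have "r \<notin> E" using r[of r] False by (auto simp: cinner_eq_zero_iff)
    define X'' where "X'' = X'(r := x)"
    have "(\<Sum>e\<in>insert r E. atensor (X'' e) e) = atensor x r + (\<Sum>e\<in>E. atensor (X'' e) e)"
      using E \<open>r \<notin> E\<close> by (simp add: X''_def)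
    also have "(\<Sum>e\<in>E. atensor (X'' e) e) = (\<Sum>e\<in>E. atensor (X' e) e)"
      using \<open>r \<notin> E\<close> by (intro sum.cong) (auto simp: X''_def)
    finally have "t + atensor x y = (\<Sum>e\<in>insert r E. atensor (X'' e) e)"
      using tx by simp
    moreover have "cinner e r = 0" if "e \<in> E" for e
      using r[OF that] cinner_commute[of e r] by simp
    ultimately show ?thesis
      using E orth r False by (intro exI[of _ "insert r E"] exI[of _ X'']) auto
  qed
qed

lemma atensor_cinner_definite:
  "0 \<le> Re (atensor_cinner t t) \<and> (Re (atensor_cinner t t) = 0 \<longleftrightarrow> t = 0)"
proof -
  obtain E X where E: "finite E" "0 \<notin> E"
    and orth: "\<And>e e'. e \<in> E \<Longrightarrow> e' \<in> E \<Longrightarrow> e \<noteq> e' \<Longrightarrow> cinner e e' = 0"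
    and t: "t = (\<Sum>e\<in>E. atensor (X e) e)"
    using algebraic_tensor_orthogonal_form[of t] by blast
  have "atensor_cinner t t = (\<Sum>e\<in>E. \<Sum>e'\<in>E. cinner (X e) (X e') * cinner e e')"
    unfolding t
    by (simp only: atensor_cinner_sum_left) (simp only: atensor_cinner_sum_right atensor_cinner_atensor)
  also have "\<dots> = (\<Sum>e\<in>E. \<Sum>e'\<in>E. if e' = e then cinner (X e) (X e) * cinner e e else 0)"
    using orth by (intro sum.cong refl) auto
  also have "\<dots> = complex_of_real (\<Sum>e\<in>E. (norm (X e))\<^sup>2 * (norm e)\<^sup>2)"
    using E by (simp add: cinner_self)
  finally have eq: "Re (atensor_cinner t t) = (\<Sum>e\<in>E. (norm (X e))\<^sup>2 * (norm e)\<^sup>2)"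
    by simp
  have "t = 0" if "Re (atensor_cinner t t) = 0"
  proof -
    have "\<forall>e\<in>E. (norm (X e))\<^sup>2 * (norm e)\<^sup>2 = 0"
      using that E unfolding eq by (subst (asm) sum_nonneg_eq_0_iff) auto
    then have "\<forall>e\<in>E. X e = 0" using E by auto
    then show ?thesis by (simp add: t)
  qed
  moreover have "0 \<le> Re (atensor_cinner t t)"
    unfolding eq by (intro sum_nonneg) simp
  ultimately show ?thesis by auto
qed

instantiation algebraic_tensor :: (complex_inner, complex_inner) complex_inner
begin

definition "cinner_algebraic_tensor = (atensor_cinner :: ('a, 'b) algebraic_tensor \<Rightarrow> _)"
definition "inner_algebraic_tensor (s :: ('a, 'b) algebraic_tensor) t = Re (cinner s t)"
definition "norm_algebraic_tensor (t :: ('a, 'b) algebraic_tensor) = sqrt (inner t t)"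
definition "dist_algebraic_tensor (s :: ('a, 'b) algebraic_tensor) t = norm (s - t)"
definition "sgn_algebraic_tensor (t :: ('a, 'b) algebraic_tensor) = inverse (norm t) *\<^sub>R t"
definition "uniformity_algebraic_tensor =
  (INF e\<in>{0<..}. principal {(s :: ('a, 'b) algebraic_tensor, t). dist s t < e})"
definition "open_algebraic_tensor (S :: ('a, 'b) algebraic_tensor set) \<longleftrightarrow>
  (\<forall>t\<in>S. \<forall>\<^sub>F (t', s) in uniformity. t' = t \<longrightarrow> s \<in> S)"

instance
proof
  fix s t u :: "('a, 'b) algebraic_tensor" and c :: complex and r :: real
    and S :: "('a, 'b) algebraic_tensor set"
  note defs = inner_algebraic_tensor_def cinner_algebraic_tensor_def
  show "dist s t = norm (s - t)" by (rule dist_algebraic_tensor_def)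
  show "sgn t = inverse (norm t) *\<^sub>R t" by (rule sgn_algebraic_tensor_def)
  show "uniformity = (INF e\<in>{0<..}. principal {(s :: ('a, 'b) algebraic_tensor, t). dist s t < e})"
    by (rule uniformity_algebraic_tensor_def)
  show "open S \<longleftrightarrow> (\<forall>t\<in>S. \<forall>\<^sub>F (t', s) in uniformity. t' = t \<longrightarrow> s \<in> S)"
    by (rule open_algebraic_tensor_def)
  show "norm t = sqrt (inner t t)" by (rule norm_algebraic_tensor_def)
  show "inner s t = Re (cinner s t)" by (rule inner_algebraic_tensor_def)
  show "cinner s t = cnj (cinner t s)"
    unfolding defs by (rule atensor_cinner_commute)
  show "cinner (s + t) u = cinner s u + cinner t u"
    unfolding defs by (rule atensor_cinner_add_left)
  show "cinner (c *\<^sub>C s) t = c * cinner s t"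
    unfolding defs by (rule atensor_cinner_scaleC_left)
  show "inner s t = inner t s"
    unfolding defs by (subst atensor_cinner_commute) simp
  show "inner (s + t) u = inner s u + inner t u"
    unfolding defs by (simp add: atensor_cinner_add_left)
  show "inner (r *\<^sub>R s) t = r * inner s t"
    unfolding defs by (simp add: scaleR_eq_scaleC atensor_cinner_scaleC_left)
  show "0 \<le> inner t t" "inner t t = 0 \<longleftrightarrow> t = 0"
    unfolding defs using atensor_cinner_definite[of t] by auto
qed

end

lemma cinner_atensor: "cinner (atensor x y) (atensor z u) = cinner x z * cinner y u"
  by (simp add: cinner_algebraic_tensor_def atensor_cinner_atensor)

section \<open>The completion of a complex inner product space\<close>

definition completion_rel :: "(nat \<Rightarrow> 'a::complex_inner) \<Rightarrow> (nat \<Rightarrow> 'a) \<Rightarrow> bool"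
  where "completion_rel X Y \<longleftrightarrow> Cauchy X \<and> Cauchy Y \<and> (\<lambda>n. X n - Y n) \<longlonglongrightarrow> 0"

lemma completion_rel_refl: "completion_rel X X \<longleftrightarrow> Cauchy X"
  by (simp add: completion_rel_def)

lemma part_equivp_completion_rel: "part_equivp completion_rel"
proof (rule part_equivpI)
  show "\<exists>X :: nat \<Rightarrow> 'a. completion_rel X X"
    unfolding completion_rel_refl by (rule exI[of _ "\<lambda>_. 0"]) (simp add: convergent_Cauchy convergent_const)
  show "symp (completion_rel :: (nat \<Rightarrow> 'a) \<Rightarrow> _)"
  proof (rule sympI)
    fix X Y :: "nat \<Rightarrow> 'a"
    assume XY: "completion_rel X Y"
    then have "(\<lambda>n. - (X n - Y n)) \<longlonglongrightarrow> - 0"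
      unfolding completion_rel_def by (intro tendsto_minus) simp
    then show "completion_rel Y X" using XY by (simp add: completion_rel_def)
  qed
  show "transp (completion_rel :: (nat \<Rightarrow> 'a) \<Rightarrow> _)"
  proof (rule transpI)
    fix X Y Z :: "nat \<Rightarrow> 'a"
    assume XYZ: "completion_rel X Y" "completion_rel Y Z"
    then have "(\<lambda>n. (X n - Y n) + (Y n - Z n)) \<longlonglongrightarrow> 0 + 0"
      unfolding completion_rel_def by (intro tendsto_add) simp_all
    then show "completion_rel X Z" using XYZ by (simp add: completion_rel_def)
  qed
qed

quotient_type (overloaded) 'a completion = "nat \<Rightarrow> 'a::complex_inner" / partial: completion_rel
  by (rule part_equivp_completion_rel)

lemma Cauchy_add_seq:
  fixes X Y :: "nat \<Rightarrow> 'a::real_normed_vector"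
  assumes "Cauchy X" "Cauchy Y"
  shows "Cauchy (\<lambda>n. X n + Y n)"
proof (rule CauchyI)
  fix e :: real assume "e > 0"
  then have e: "e / 2 > 0" by simp
  obtain M N where MN: "\<And>m n. m \<ge> M \<Longrightarrow> n \<ge> M \<Longrightarrow> norm (X m - X n) < e / 2"
    "\<And>m n. m \<ge> N \<Longrightarrow> n \<ge> N \<Longrightarrow> norm (Y m - Y n) < e / 2"
    using CauchyD[OF assms(1) e] CauchyD[OF assms(2) e] by blast
  have "norm ((X m - X n) + (Y m - Y n)) < e" if "m \<ge> max M N" "n \<ge> max M N" for m n
  proof -
    have "norm (X m - X n) + norm (Y m - Y n) < e / 2 + e / 2"
      using that MN by (intro add_strict_mono) auto
    then show ?thesis by (intro norm_triangle_lt) simp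
  qed
  then show "\<exists>M. \<forall>m\<ge>M. \<forall>n\<ge>M. norm (X m + Y m - (X n + Y n)) < e"
    by (intro exI[of _ "max M N"]) (simp add: algebra_simps)
qed

lemma bounded_linear_scaleC: "bounded_linear (\<lambda>x::'a::complex_inner. c *\<^sub>C x)"
  by (rule bounded_linear_intro[of _ "cmod c"])
     (simp_all add: scaleC_add_right scaleR_eq_scaleC scaleC_scaleC norm_scaleC mult.commute)

lemma Cauchy_scaleC_seq: "Cauchy X \<Longrightarrow> Cauchy (\<lambda>n. c *\<^sub>C (X n :: 'a::complex_inner))"
  by (rule bounded_linear.Cauchy[OF bounded_linear_scaleC])

lemma Cauchy_minus_seq: "Cauchy X \<Longrightarrow> Cauchy (\<lambda>n. - (X n :: 'a::complex_inner))"
  by (rule bounded_linear.Cauchy[OF bounded_linear_minus[OF bounded_linear_ident]])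

lemma cinner_diff_bound:
  "cmod (cinner x y - cinner x' y') \<le> norm (x - x') * norm y + norm x' * norm (y - (y'::'a::complex_inner))"
proof -
  have "cinner x y - cinner x' y' = cinner (x - x') y + cinner x' (y - y')"
    by (simp add: cinner_diff_left cinner_diff_right)
  then show ?thesis
    by (simp add: norm_triangle_le add_mono cinner_Cauchy_Schwarz)
qed

lemma cinner_seq_diff_tendsto:
  fixes X X' Y Y' :: "'i \<Rightarrow> 'a::complex_inner"
  assumes "((\<lambda>n. X n - X' n) \<longlongrightarrow> 0) F" "((\<lambda>n. Y n - Y' n) \<longlongrightarrow> 0) F"
    and "Bfun Y F" "Bfun X' F"
  shows "((\<lambda>n. cinner (X n) (Y n) - cinner (X' n) (Y' n)) \<longlongrightarrow> 0) F"
proof -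
  have "Zfun (\<lambda>n. norm (X n - X' n) * norm (Y n) + norm (X' n) * norm (Y n - Y' n)) F"
    using assms
    by (intro Zfun_add bounded_bilinear.Zfun_prod_Bfun[OF bounded_bilinear_mult]
        bounded_bilinear.Bfun_prod_Zfun[OF bounded_bilinear_mult])
       (simp_all add: tendsto_Zfun_iff Zfun_norm_iff Bfun_def)
  then have "Zfun (\<lambda>n. cinner (X n) (Y n) - cinner (X' n) (Y' n)) F"
    by (rule Zfun_le) (auto intro!: order_trans[OF cinner_diff_bound])
  then show ?thesis by (simp add: tendsto_Zfun_iff)
qed

lemma Cauchy_cinner_convergent:
  fixes X Y :: "nat \<Rightarrow> 'a::complex_inner"
  assumes "Cauchy X" "Cauchy Y"
  shows "convergent (\<lambda>n. cinner (X n) (Y n))"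
proof -
  obtain B where B: "B > 0" "\<And>n. norm (X n) \<le> B" "\<And>n. norm (Y n) \<le> B"
  proof -
    obtain K L where "K > 0" "\<forall>n. norm (X n) \<le> K" "\<forall>n. norm (Y n) \<le> L"
      using Cauchy_Bseq[OF assms(1)] Cauchy_Bseq[OF assms(2)] by (auto simp: Bseq_def)
    then show ?thesis by (intro that[of "max K L"]) (auto simp: max_def intro: order_trans)
  qed
  have "Cauchy (\<lambda>n. cinner (X n) (Y n))"
  proof (rule CauchyI)
    fix e :: real assume "e > 0"
    then have e: "e / (2 * B) > 0" using B by simp
    obtain M N where M: "\<And>m n. m \<ge> M \<Longrightarrow> n \<ge> M \<Longrightarrow> norm (X m - X n) < e / (2 * B)"
      and N: "\<And>m n. m \<ge> N \<Longrightarrow> n \<ge> N \<Longrightarrow> norm (Y m - Y n) < e / (2 * B)"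
      using CauchyD[OF assms(1) e] CauchyD[OF assms(2) e] by blast
    have "norm (cinner (X m) (Y m) - cinner (X n) (Y n)) < e"
      if mn: "m \<ge> max M N" "n \<ge> max M N" for m n
    proof -
      have "norm (cinner (X m) (Y m) - cinner (X n) (Y n))
          \<le> norm (X m - X n) * norm (Y m) + norm (X n) * norm (Y m - Y n)"
        by (rule cinner_diff_bound)
      also have "\<dots> \<le> norm (X m - X n) * B + B * norm (Y m - Y n)"
        using B by (intro add_mono mult_mono) (auto intro: less_imp_le)
      also have "\<dots> < e / (2 * B) * B + B * (e / (2 * B))"
        using B M[of m n] N[of m n] mn
        by (intro add_strict_mono mult_strict_right_mono mult_strict_left_mono) auto
      also have "\<dots> = e" using B by simp
      finally show ?thesis .
    qed
    then show "\<exists>M. \<forall>m\<ge>M. \<forall>n\<ge>M. norm (cinner (X m) (Y m) - cinner (X n) (Y n)) < e"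
      by blast
  qed
  then show ?thesis by (simp add: Cauchy_convergent_iff)
qed

instantiation completion :: (complex_inner) complex_inner
begin

lift_definition zero_completion :: "'a completion" is "\<lambda>_. 0"
  unfolding completion_rel_refl by (simp add: convergent_Cauchy convergent_const)

lift_definition plus_completion :: "'a completion \<Rightarrow> 'a completion \<Rightarrow> 'a completion"
  is "\<lambda>X Y n. X n + Y n"
proof -
  fix X X' Y Y' :: "nat \<Rightarrow> 'a"
  assume XY: "completion_rel X X'" "completion_rel Y Y'"
  then have "(\<lambda>n. (X n - X' n) + (Y n - Y' n)) \<longlonglongrightarrow> 0 + 0"
    unfolding completion_rel_def by (intro tendsto_add) simp_all
  then show "completion_rel (\<lambda>n. X n + Y n) (\<lambda>n. X' n + Y' n)"
    using XY by (simp add: completion_rel_def Cauchy_add_seq add_diff_add)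
qed

lift_definition scaleC_completion :: "complex \<Rightarrow> 'a completion \<Rightarrow> 'a completion"
  is "\<lambda>c X n. c *\<^sub>C X n"
proof -
  fix c :: complex and X X' :: "nat \<Rightarrow> 'a"
  assume X: "completion_rel X X'"
  then have "(\<lambda>n. c *\<^sub>C (X n - X' n)) \<longlonglongrightarrow> 0"
    unfolding completion_rel_def
    by (intro bounded_linear.tendsto_zero[OF bounded_linear_scaleC]) simp
  then show "completion_rel (\<lambda>n. c *\<^sub>C X n) (\<lambda>n. c *\<^sub>C X' n)"
    using X by (simp add: completion_rel_def Cauchy_scaleC_seq complex_vector.scale_right_diff_distrib)
qed

lift_definition uminus_completion :: "'a completion \<Rightarrow> 'a completion"
  is "\<lambda>X n. - X n"
proof -
  fix X X' :: "nat \<Rightarrow> 'a"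
  assume X: "completion_rel X X'"
  then have "(\<lambda>n. - (X n - X' n)) \<longlonglongrightarrow> - 0"
    unfolding completion_rel_def by (intro tendsto_minus) simp
  then show "completion_rel (\<lambda>n. - X n) (\<lambda>n. - X' n)"
    using X by (simp add: completion_rel_def Cauchy_minus_seq)
qed

lift_definition cinner_completion :: "'a completion \<Rightarrow> 'a completion \<Rightarrow> complex"
  is "\<lambda>X Y. lim (\<lambda>n. cinner (X n) (Y n))"
proof -
  fix X X' Y Y' :: "nat \<Rightarrow> 'a"
  assume XY: "completion_rel X X'" "completion_rel Y Y'"
  then have "(\<lambda>n. cinner (X n) (Y n) - cinner (X' n) (Y' n)) \<longlonglongrightarrow> 0"
    by (intro cinner_seq_diff_tendsto) (auto simp: completion_rel_def intro: Cauchy_Bseq)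
  moreover have "(\<lambda>n. cinner (X' n) (Y' n)) \<longlonglongrightarrow> lim (\<lambda>n. cinner (X' n) (Y' n))"
    unfolding convergent_LIMSEQ_iff[symmetric]
    using XY by (intro Cauchy_cinner_convergent) (auto simp: completion_rel_def)
  ultimately have "(\<lambda>n. (cinner (X n) (Y n) - cinner (X' n) (Y' n)) + cinner (X' n) (Y' n))
      \<longlonglongrightarrow> 0 + lim (\<lambda>n. cinner (X' n) (Y' n))"
    by (rule tendsto_add)
  then show "lim (\<lambda>n. cinner (X n) (Y n)) = lim (\<lambda>n. cinner (X' n) (Y' n))"
    by (simp add: limI)
qed

definition "minus_completion (x :: 'a completion) y = x + - y"
definition "scaleR_completion r (x :: 'a completion) = complex_of_real r *\<^sub>C x"
definition "inner_completion (x :: 'a completion) y = Re (cinner x y)"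
definition "norm_completion (x :: 'a completion) = sqrt (inner x x)"
definition "dist_completion (x :: 'a completion) y = norm (x - y)"
definition "sgn_completion (x :: 'a completion) = inverse (norm x) *\<^sub>R x"
definition "uniformity_completion =
  (INF e\<in>{0<..}. principal {(x :: 'a completion, y). dist x y < e})"
definition "open_completion (S :: 'a completion set) \<longleftrightarrow>
  (\<forall>x\<in>S. \<forall>\<^sub>F (x', y) in uniformity. x' = x \<longrightarrow> y \<in> S)"

lemma cinner_completion_tendsto:
  assumes "Cauchy X" "Cauchy (Y :: nat \<Rightarrow> 'a)"
  shows "(\<lambda>n. cinner (X n) (Y n)) \<longlonglongrightarrow> cinner (abs_completion X) (abs_completion Y)"
proof -
  have "cinner (abs_completion X) (abs_completion Y) = lim (\<lambda>n. cinner (X n) (Y n))"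
    using assms by (intro cinner_completion.abs_eq) (simp_all add: completion_rel_refl)
  then show ?thesis
    using Cauchy_cinner_convergent[OF assms] by (simp add: convergent_LIMSEQ_iff)
qed

lemma completion_cases:
  obtains X where "Cauchy X" "x = abs_completion (X :: nat \<Rightarrow> 'a)"
proof -
  have "\<exists>X. Cauchy X \<and> x = abs_completion X"
    by (induction x rule: completion.abs_induct) (auto simp: completion_rel_refl)
  then show ?thesis using that by blast
qed

lemma abs_completion_add:
  "Cauchy X \<Longrightarrow> Cauchy Y \<Longrightarrow>
    abs_completion X + abs_completion Y = abs_completion (\<lambda>n. X n + (Y n :: 'a))"
  by (simp add: plus_completion.abs_eq completion_rel_refl)

lemma abs_completion_minus: "Cauchy X \<Longrightarrow> - abs_completion X = abs_completion (\<lambda>n. - (X n :: 'a))"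
  by (simp add: uminus_completion.abs_eq completion_rel_refl)

lemma abs_completion_scaleC:
  "Cauchy X \<Longrightarrow> c *\<^sub>C abs_completion X = abs_completion (\<lambda>n. c *\<^sub>C (X n :: 'a))"
  by (simp add: scaleC_completion.abs_eq completion_rel_refl)

lemmas abs_completion_simps = abs_completion_add abs_completion_minus abs_completion_scaleC

lemma zero_completion_eq: "0 = abs_completion (\<lambda>_. 0 :: 'a)"
  by (simp add: zero_completion_def)

lemma completion_eq_iff:
  fixes X Y :: "nat \<Rightarrow> 'a"
  assumes "Cauchy X" "Cauchy Y"
  shows "abs_completion X = abs_completion Y \<longleftrightarrow> (\<lambda>n. X n - Y n) \<longlonglongrightarrow> 0"
proof -
  have "completion_rel X Y \<longleftrightarrow> abs_completion X = abs_completion Y"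
    using Quotient_rel[OF Quotient_completion, of X Y] assms by (simp add: completion_rel_refl)
  then show ?thesis using assms by (simp add: completion_rel_def)
qed

lemma completion_definite:
  "0 \<le> Re (cinner x x) \<and> (Re (cinner x x) = 0 \<longleftrightarrow> x = (0 :: 'a completion))"
proof -
  obtain X where X: "Cauchy X" "x = abs_completion X" by (rule completion_cases)
  have "(\<lambda>n. cinner (X n) (X n)) \<longlonglongrightarrow> cinner x x"
    unfolding X(2) by (rule cinner_completion_tendsto) (rule X)+
  then have lim: "(\<lambda>n. (norm (X n))\<^sup>2) \<longlonglongrightarrow> Re (cinner x x)"
    by (drule_tac tendsto_Re) (simp add: cinner_self)
  then have "0 \<le> Re (cinner x x)"
    by (rule LIMSEQ_le_const) simp
  moreover have "Re (cinner x x) = 0 \<longleftrightarrow> (\<lambda>n. (norm (X n))\<^sup>2) \<longlonglongrightarrow> 0"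
  proof
    assume "Re (cinner x x) = 0"
    with lim show "(\<lambda>n. (norm (X n))\<^sup>2) \<longlonglongrightarrow> 0" by simp
  next
    assume "(\<lambda>n. (norm (X n))\<^sup>2) \<longlonglongrightarrow> 0"
    with lim show "Re (cinner x x) = 0" by (rule LIMSEQ_unique)
  qed
  moreover have "(\<lambda>n. (norm (X n))\<^sup>2) \<longlonglongrightarrow> 0 \<longleftrightarrow> X \<longlonglongrightarrow> 0"
  proof
    assume "(\<lambda>n. (norm (X n))\<^sup>2) \<longlonglongrightarrow> 0"
    then have "(\<lambda>n. sqrt ((norm (X n))\<^sup>2)) \<longlonglongrightarrow> sqrt 0" by (rule tendsto_real_sqrt)
    then show "X \<longlonglongrightarrow> 0" by (simp add: tendsto_norm_zero_iff)
  next
    assume "X \<longlonglongrightarrow> 0"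
    then have "(\<lambda>n. (norm (X n))\<^sup>2) \<longlonglongrightarrow> (norm (0::'a))\<^sup>2" by (intro tendsto_intros)
    then show "(\<lambda>n. (norm (X n))\<^sup>2) \<longlonglongrightarrow> 0" by simp
  qed
  moreover have "X \<longlonglongrightarrow> 0 \<longleftrightarrow> x = 0"
    unfolding X(2) zero_completion_eq using X(1)
    by (subst completion_eq_iff) (simp_all add: convergent_Cauchy convergent_const)
  ultimately show ?thesis by simp
qed

lemma completion_cinner_commute: "cinner x y = cnj (cinner y (x :: 'a completion))"
proof -
  obtain X where X: "Cauchy X" "x = abs_completion X" by (rule completion_cases)
  obtain Y where Y: "Cauchy Y" "y = abs_completion Y" by (rule completion_cases)
  have "(\<lambda>n. cnj (cinner (Y n) (X n))) \<longlonglongrightarrow> cnj (cinner y x)"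
    unfolding X Y by (intro tendsto_cnj cinner_completion_tendsto X Y)
  moreover have "(\<lambda>n. cinner (X n) (Y n)) \<longlonglongrightarrow> cinner x y"
    unfolding X Y by (intro cinner_completion_tendsto X Y)
  ultimately show ?thesis
    by (simp add: cinner_commute[symmetric] LIMSEQ_unique)
qed

lemma completion_cinner_add_left:
  "cinner (x + y) z = cinner x z + cinner y (z :: 'a completion)"
proof -
  obtain X where X: "Cauchy X" "x = abs_completion X" by (rule completion_cases)
  obtain Y where Y: "Cauchy Y" "y = abs_completion Y" by (rule completion_cases)
  obtain Z where Z: "Cauchy Z" "z = abs_completion Z" by (rule completion_cases)
  have "(\<lambda>n. cinner (X n + Y n) (Z n)) \<longlonglongrightarrow> cinner (x + y) z"
    unfolding X Y Z abs_completion_add[OF X(1) Y(1)]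
    by (intro cinner_completion_tendsto Cauchy_add_seq X Y Z)
  moreover have "(\<lambda>n. cinner (X n) (Z n) + cinner (Y n) (Z n)) \<longlonglongrightarrow> cinner x z + cinner y z"
    unfolding X Y Z by (intro tendsto_add cinner_completion_tendsto X Y Z)
  ultimately show ?thesis
    by (simp add: cinner_add_left LIMSEQ_unique)
qed

lemma completion_cinner_scaleC_left:
  "cinner (c *\<^sub>C x) y = c * cinner x (y :: 'a completion)"
proof -
  obtain X where X: "Cauchy X" "x = abs_completion X" by (rule completion_cases)
  obtain Y where Y: "Cauchy Y" "y = abs_completion Y" by (rule completion_cases)
  have "(\<lambda>n. cinner (c *\<^sub>C X n) (Y n)) \<longlonglongrightarrow> cinner (c *\<^sub>C x) y"
    unfolding X Y abs_completion_scaleC[OF X(1)]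
    by (intro cinner_completion_tendsto Cauchy_scaleC_seq X Y)
  moreover have "(\<lambda>n. c * cinner (X n) (Y n)) \<longlonglongrightarrow> c * cinner x y"
    unfolding X Y by (intro tendsto_mult_left cinner_completion_tendsto X Y)
  ultimately show ?thesis
    by (simp add: cinner_scaleC_left LIMSEQ_unique)
qed

instance
proof
  fix x y z :: "'a completion" and a b c :: complex and r q :: real and S :: "'a completion set"
  obtain X where X: "Cauchy X" "x = abs_completion X" by (rule completion_cases)
  obtain Y where Y: "Cauchy Y" "y = abs_completion Y" by (rule completion_cases)
  obtain Z where Z: "Cauchy Z" "z = abs_completion Z" by (rule completion_cases)
  note C = X(1) Y(1) Z(1) Cauchy_add_seq Cauchy_scaleC_seq Cauchy_minus_seq
  have C0: "Cauchy (\<lambda>_. 0 :: 'a)" by (simp add: convergent_Cauchy convergent_const)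
  show "x + y + z = x + (y + z)"
    by (simp add: X(2) Y(2) Z(2) abs_completion_simps C add.assoc)
  show "x + y = y + x"
    by (simp add: X(2) Y(2) abs_completion_simps C add.commute)
  show "0 + x = x"
    by (simp add: X(2) zero_completion_eq abs_completion_simps C C0)
  show "- x + x = 0"
    by (simp add: X(2) zero_completion_eq abs_completion_simps C)
  show "x - y = x + - y"
    by (rule minus_completion_def)
  have add_right: "a *\<^sub>C (x + y) = a *\<^sub>C x + a *\<^sub>C y" for a
    by (simp add: X(2) Y(2) abs_completion_simps C scaleC_add_right)
  have add_left: "(a + b) *\<^sub>C x = a *\<^sub>C x + b *\<^sub>C x" for a b
    by (simp add: X(2) abs_completion_simps C scaleC_add_left)
  have scale: "a *\<^sub>C b *\<^sub>C x = (a * b) *\<^sub>C x" for a b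
    by (simp add: X(2) abs_completion_simps C scaleC_scaleC)
  show "a *\<^sub>C (x + y) = a *\<^sub>C x + a *\<^sub>C y" by (rule add_right)
  show "(a + b) *\<^sub>C x = a *\<^sub>C x + b *\<^sub>C x" by (rule add_left)
  show "a *\<^sub>C b *\<^sub>C x = (a * b) *\<^sub>C x" by (rule scale)
  show "r *\<^sub>R x = complex_of_real r *\<^sub>C x" by (rule scaleR_completion_def)
  show "r *\<^sub>R (x + y) = r *\<^sub>R x + r *\<^sub>R y"
    unfolding scaleR_completion_def by (rule add_right)
  show "(r + q) *\<^sub>R x = r *\<^sub>R x + q *\<^sub>R x"
    unfolding scaleR_completion_def of_real_add by (rule add_left)
  show "r *\<^sub>R q *\<^sub>R x = (r * q) *\<^sub>R x"
    unfolding scaleR_completion_def of_real_mult by (rule scale)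
  show "1 *\<^sub>R x = x"
    by (simp add: scaleR_completion_def X(2) abs_completion_simps C scaleC_one)
  show "dist x y = norm (x - y)" by (rule dist_completion_def)
  show "sgn x = inverse (norm x) *\<^sub>R x" by (rule sgn_completion_def)
  show "uniformity = (INF e\<in>{0<..}. principal {(x :: 'a completion, y). dist x y < e})"
    by (rule uniformity_completion_def)
  show "open S \<longleftrightarrow> (\<forall>x\<in>S. \<forall>\<^sub>F (x', y) in uniformity. x' = x \<longrightarrow> y \<in> S)"
    by (rule open_completion_def)
  show "norm x = sqrt (inner x x)" by (rule norm_completion_def)
  show "inner x y = Re (cinner x y)" by (rule inner_completion_def)
  show "cinner x y = cnj (cinner y x)" by (rule completion_cinner_commute)
  show "cinner (x + y) z = cinner x z + cinner y z" by (rule completion_cinner_add_left)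
  show "cinner (c *\<^sub>C x) y = c * cinner x y" by (rule completion_cinner_scaleC_left)
  show "inner x y = inner y x"
    unfolding inner_completion_def by (subst completion_cinner_commute) simp
  show "inner (x + y) z = inner x z + inner y z"
    by (simp add: inner_completion_def completion_cinner_add_left)
  show "inner (r *\<^sub>R x) y = r * inner x y"
    by (simp add: inner_completion_def scaleR_completion_def completion_cinner_scaleC_left)
  show "0 \<le> inner x x" "inner x x = 0 \<longleftrightarrow> x = 0"
    unfolding inner_completion_def using completion_definite[of x] by auto
qed

end

lift_definition to_completion :: "'a::complex_inner \<Rightarrow> 'a completion" is "\<lambda>x _. x"
  unfolding completion_rel_refl by (simp add: convergent_Cauchy convergent_const)

lemma Cauchy_const_seq: "Cauchy (\<lambda>_. x :: 'a::complex_inner)"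
  by (simp add: convergent_Cauchy convergent_const)

lemma to_completion_eq: "to_completion x = abs_completion (\<lambda>_. x)"
  by (simp add: to_completion_def)

lemma cinner_to_completion: "cinner (to_completion x) (to_completion y) = cinner x y"
proof -
  have "(\<lambda>_::nat. cinner x y) \<longlonglongrightarrow> cinner (to_completion x) (to_completion y)"
    unfolding to_completion_eq by (rule cinner_completion_tendsto) (rule Cauchy_const_seq)+
  then show ?thesis by (simp add: LIMSEQ_const_iff)
qed

lemma to_completion_add: "to_completion (x + y) = to_completion x + to_completion y"
  unfolding to_completion_eq by (simp add: abs_completion_simps Cauchy_const_seq)

lemma to_completion_scaleC: "to_completion (c *\<^sub>C x) = c *\<^sub>C to_completion x"
  unfolding to_completion_eq by (simp add: abs_completion_simps Cauchy_const_seq)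

lemma to_completion_diff: "to_completion (x - y) = to_completion x - to_completion y"
  using to_completion_add[of "x - y" y] by simp

lemma norm_to_completion: "norm (to_completion x) = norm x"
  by (simp add: norm_eq_sqrt_inner inner_eq_Re_cinner cinner_to_completion)

lemma to_completion_tendsto:
  assumes "Cauchy X"
  shows "(\<lambda>n. to_completion (X n)) \<longlonglongrightarrow> abs_completion X"
proof (rule LIMSEQ_I)
  fix e :: real assume "e > 0"
  obtain M where M: "\<And>m n. m \<ge> M \<Longrightarrow> n \<ge> M \<Longrightarrow> norm (X m - X n) < e / 2"
    using CauchyD[OF assms half_gt_zero[OF \<open>e > 0\<close>]] by blast
  have "norm (to_completion (X n) - abs_completion X) < e" if n: "n \<ge> M" for n
  proof -
    have C: "Cauchy (\<lambda>m. X n + (- X m))"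
      by (intro Cauchy_add_seq Cauchy_minus_seq Cauchy_const_seq assms)
    define d where "d = to_completion (X n) - abs_completion X"
    have "d = abs_completion (\<lambda>m. X n + (- X m))"
      unfolding d_def to_completion_eq diff_conv_add_uminus
      by (simp add: abs_completion_simps Cauchy_const_seq Cauchy_minus_seq assms
          del: add_uminus_conv_diff)
    then have "(\<lambda>m. cinner (X n + (- X m)) (X n + (- X m))) \<longlonglongrightarrow> cinner d d"
      using cinner_completion_tendsto[OF C C] by simp
    then have "(\<lambda>m. (norm (X n - X m))\<^sup>2) \<longlonglongrightarrow> (norm d)\<^sup>2"
      by (drule_tac tendsto_Re) (simp add: cinner_self)
    moreover have "\<exists>N. \<forall>m\<ge>N. (norm (X n - X m))\<^sup>2 \<le> (e / 2)\<^sup>2"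
      using M n by (intro exI[of _ M] allI impI power_mono) (auto intro: less_imp_le)
    ultimately have "(norm d)\<^sup>2 \<le> (e / 2)\<^sup>2" by (rule LIMSEQ_le_const2)
    then have "norm d \<le> e / 2" using \<open>e > 0\<close> by (simp add: power2_le_iff_abs_le)
    then show ?thesis using \<open>e > 0\<close> by (simp add: d_def)
  qed
  then show "\<exists>M. \<forall>n\<ge>M. norm (to_completion (X n) - abs_completion X) < e" by blast
qed

lemma to_completion_dense: "closure (range to_completion) = (UNIV :: 'a::complex_inner completion set)"
proof -
  have "x \<in> closure (range to_completion)" for x :: "'a completion"
  proof -
    obtain X where X: "Cauchy X" "x = abs_completion X" by (rule completion_cases)
    then show ?thesis
      unfolding closure_sequential
      by (intro exI[of _ "\<lambda>n. to_completion (X n)"]) (simp add: to_completion_tendsto)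
  qed
  then show ?thesis by blast
qed

instance completion :: (complex_inner) chilbert_space
proof
  fix S :: "nat \<Rightarrow> 'a completion"
  assume S: "Cauchy S"
  have "\<exists>x. dist (to_completion x) (S n) < inverse (real (Suc n))" for n
  proof -
    have "S n \<in> closure (range to_completion)" by (simp add: to_completion_dense)
    then have "\<exists>y\<in>range to_completion. dist y (S n) < inverse (real (Suc n))"
      unfolding closure_approachable by (elim allE[of _ "inverse (real (Suc n))"]) simp
    then show ?thesis by blast
  qed
  then obtain X where X: "\<And>n. dist (to_completion (X n)) (S n) < inverse (real (Suc n))" by metis
  have diff: "(\<lambda>n. to_completion (X n) - S n) \<longlonglongrightarrow> 0"
    by (rule Lim_null_comparison[OF _ LIMSEQ_inverse_real_of_nat])
       (use X in \<open>auto simp: dist_norm intro!: always_eventually less_imp_le\<close>)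
  then have "Cauchy (\<lambda>n. to_completion (X n) - S n)"
    by (intro convergent_Cauchy) (auto simp: convergent_def)
  from Cauchy_add_seq[OF this S] have "Cauchy (\<lambda>n. to_completion (X n))" by simp
  then have "Cauchy X"
    unfolding Cauchy_iff by (simp add: to_completion_diff[symmetric] norm_to_completion)
  then have "(\<lambda>n. to_completion (X n) - (to_completion (X n) - S n)) \<longlonglongrightarrow> abs_completion X - 0"
    by (intro tendsto_diff to_completion_tendsto diff)
  then show "convergent S" by (auto simp: convergent_def)
qed

section \<open>The Hilbert space tensor product\<close>

type_synonym ('a, 'b) hilbert_tensor = "('a, 'b) algebraic_tensor completion"

definition htensor ::
  "'a::complex_inner \<Rightarrow> 'b::complex_inner \<Rightarrow> ('a, 'b) hilbert_tensor"  (infixr "\<otimes>\<^sub>H" 70)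
  where "x \<otimes>\<^sub>H y = to_completion (atensor x y)"

lemma cinner_htensor: "cinner (x \<otimes>\<^sub>H y) (z \<otimes>\<^sub>H u) = cinner x z * cinner y u"
  by (simp add: htensor_def cinner_to_completion cinner_atensor)

lemma cspan_htensor_dense:
  "closure (cspan {x \<otimes>\<^sub>H y | x y. True}) =
    (UNIV :: ('a::complex_inner, 'b::complex_inner) hilbert_tensor set)"
proof -
  have "to_completion t \<in> cspan {x \<otimes>\<^sub>H y | x y. True}" for t :: "('a, 'b) algebraic_tensor"
  proof (induction t rule: algebraic_tensor_induct)
    case zero
    have "to_completion (0 :: ('a, 'b) algebraic_tensor) = 0"
      using to_completion_add[of 0 "0 :: ('a, 'b) algebraic_tensor"] by simp
    then show ?case by (simp add: complex_vector.span_zero)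
  next
    case (add t x y)
    have "x \<otimes>\<^sub>H y \<in> cspan {x \<otimes>\<^sub>H y | x y. True}"
      by (rule complex_vector.span_base) blast
    with add show ?case
      unfolding to_completion_add htensor_def[symmetric] by (rule complex_vector.span_add)
  qed
  then have "closure (range to_completion) \<subseteq>
      closure (cspan {x \<otimes>\<^sub>H y | (x :: 'a) (y :: 'b). True})"
    by (intro closure_mono) auto
  then show ?thesis using to_completion_dense by blast
qed

section \<open>Operators\<close>

definition bounded_clinear :: "('a::complex_inner \<Rightarrow> 'b::complex_inner) \<Rightarrow> bool"
  where "bounded_clinear T \<longleftrightarrow> bounded_linear T \<and> (\<forall>c x. T (c *\<^sub>C x) = c *\<^sub>C T x)"

text \<open>
  The descriptions below denote: adjoints exist by the Riesz representation theorem, and \<open>A \<otimes>\<^sub>o B\<close>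
  exists for bounded \<open>A\<close> and \<open>B\<close> and is unique because the elementary tensors span a dense subspace.
\<close>

definition cadjoint ::
  "('a::chilbert_space \<Rightarrow> 'b::chilbert_space) \<Rightarrow> 'b \<Rightarrow> 'a"  ("_\<^sup>\<dagger>" [1000] 1000)
  where "T\<^sup>\<dagger> = (THE S. bounded_clinear S \<and> (\<forall>x y. cinner (T x) y = cinner x (S y)))"

definition htensor_op ::
  "('a::complex_inner \<Rightarrow> 'c::complex_inner) \<Rightarrow> ('b::complex_inner \<Rightarrow> 'd::complex_inner) \<Rightarrow>
   ('a, 'b) hilbert_tensor \<Rightarrow> ('c, 'd) hilbert_tensor"  (infixr "\<otimes>\<^sub>o" 70)
  where "A \<otimes>\<^sub>o B = (THE T. bounded_clinear T \<and> (\<forall>x y. T (x \<otimes>\<^sub>H y) = A x \<otimes>\<^sub>H B y))"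

text \<open>
  The supremum is taken in \<open>[0, \<infinity>)\<close>: inserting \<open>0\<close> changes nothing unless the space is trivial,
  when there are no unit vectors and the numerical radius is \<open>0\<close>.
\<close>

definition numerical_radius :: "('a::complex_inner \<Rightarrow> 'a) \<Rightarrow> real"
  where "numerical_radius T = Sup (insert 0 {cmod (cinner (T x) x) | x. norm x = 1})"

end

theory Submission
  imports Defs
begin

text \<open>
  Put \<open>T = A \<otimes> B\<close>. On elementary tensors the adjoint of \<open>T\<close> is \<open>A\<^sup>\<dagger> \<otimes> B\<^sup>\<dagger>\<close>, and products of tensor
  operators multiply factorwise, so the operator inside the norm is \<open>S = T\<^sup>\<dagger>T + TT\<^sup>\<dagger>\<close>. For a unit
  vector \<open>x\<close> the number \<open>\<langle>Tx, x\<rangle> = \<langle>x, T\<^sup>\<dagger>x\<rangle>\<close> is bounded in modulus by both \<open>\<parallel>Tx\<parallel>\<close> and \<open>\<parallel>T\<^sup>\<dagger>x\<parallel>\<close>,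
  so that
  \<open>2 |\<langle>Tx, x\<rangle>|\<^sup>2 \<le> \<parallel>Tx\<parallel>\<^sup>2 + \<parallel>T\<^sup>\<dagger>x\<parallel>\<^sup>2 = \<langle>Sx, x\<rangle> \<le> \<parallel>S\<parallel>\<close>;
  the supremum over \<open>x\<close> is the first inequality. The second is
  \<open>\<parallel>S\<parallel> \<le> 2 \<parallel>T\<parallel> \<parallel>T\<^sup>\<dagger>\<parallel> \<le> 2 \<parallel>A\<parallel>\<^sup>2 \<parallel>B\<parallel>\<^sup>2\<close>, by \<open>\<parallel>A \<otimes> B\<parallel> \<le> \<parallel>A\<parallel> \<parallel>B\<parallel>\<close> and \<open>\<parallel>A\<^sup>\<dagger>\<parallel> \<le> \<parallel>A\<parallel>\<close>.

  The substance is that the operators exist. Adjoints come from the Riesz representation theorem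
  (\<open>Riesz_representation_real\<close>), proved by minimising \<open>\<parallel>x\<parallel>\<^sup>2 - 2 f(x)\<close>. The operator \<open>A \<otimes> B\<close> is first
  obtained on the algebraic tensor product from the universal property
  (\<open>algebraic_tensor_universal\<close>). Its bound uses the factorisation
  \<open>A \<otimes> B = (1 \<otimes> B)(A \<otimes> 1)\<close>: if \<open>t = \<Sum> x\<^sub>e \<otimes> e\<close> with orthogonal \<open>e\<close>, then
  \<open>\<parallel>t\<parallel>\<^sup>2 = \<Sum> \<parallel>x\<^sub>e\<parallel>\<^sup>2 \<parallel>e\<parallel>\<^sup>2\<close>, which makes \<open>\<parallel>A \<otimes> 1\<parallel> \<le> \<parallel>A\<parallel>\<close> visible, and \<open>1 \<otimes> B\<close> is conjugate to
  \<open>B \<otimes> 1\<close> under the isometry that exchanges the factors. Completeness extends the operator to the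
  Hilbert space tensor product, and density of the span of the elementary tensors makes it unique.
\<close>

section \<open>Bounded complex linear maps\<close>

lemma bounded_clinearI:
  fixes T :: "'a::complex_inner \<Rightarrow> 'b::complex_inner"
  assumes "\<And>x y. T (x + y) = T x + T y" and "\<And>c x. T (c *\<^sub>C x) = c *\<^sub>C T x"
    and "\<And>x. norm (T x) \<le> K * norm x"
  shows "bounded_clinear T"
  unfolding bounded_clinear_def
  by (intro conjI bounded_linear_intro[of T K]) (simp_all add: assms scaleR_eq_scaleC mult.commute)

lemma bounded_clinear_bounded_linear: "bounded_clinear T \<Longrightarrow> bounded_linear T"
  by (simp add: bounded_clinear_def)

lemma bounded_clinear_scaleC: "bounded_clinear T \<Longrightarrow> T (c *\<^sub>C x) = c *\<^sub>C T x"
  by (simp add: bounded_clinear_def)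

lemma bounded_clinear_add: "bounded_clinear T \<Longrightarrow> T (x + y) = T x + T y"
  by (simp add: bounded_clinear_def linear_add bounded_linear.linear)

lemma bounded_clinear_norm: "bounded_clinear T \<Longrightarrow> norm (T x) \<le> onorm T * norm x"
  by (simp add: bounded_clinear_def onorm)

lemma bounded_clinear_compose:
  assumes "bounded_clinear S" "bounded_clinear T"
  shows "bounded_clinear (S \<circ> T)"
  using assms bounded_linear_compose[of S T] by (simp add: bounded_clinear_def o_def)

section \<open>The Riesz representation theorem and adjoints\<close>

text \<open>
  Minimise \<open>J(x) = \<parallel>x\<parallel>\<^sup>2 - 2 f(x)\<close>, which is bounded below by \<open>- \<parallel>f\<parallel>\<^sup>2\<close>. The parallelogram law
  reads \<open>\<parallel>x - y\<parallel>\<^sup>2 = 2 J(x) + 2 J(y) - 4 J((x + y) / 2)\<close>, so a minimising sequence is Cauchy. At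
  its limit the derivative of \<open>J\<close> in every direction vanishes, and this is the claim.
\<close>

lemma Riesz_representation_real:
  fixes f :: "'a::{real_inner, complete_space} \<Rightarrow> real"
  assumes f: "bounded_linear f"
  obtains z where "\<And>x. f x = inner x z"
proof -
  interpret f: bounded_linear f by fact
  define J where "J x = (norm x)\<^sup>2 - 2 * f x" for x
  define m where "m = Inf (range J)"
  have lower: "- (onorm f)\<^sup>2 \<le> J x" for x
  proof -
    have "f x \<le> onorm f * norm x" using onorm[OF f, of x] by simp
    moreover have "0 \<le> (norm x - onorm f)\<^sup>2" by simp
    ultimately show ?thesis by (simp add: J_def power2_eq_square algebra_simps)
  qed
  have bdd: "bdd_below (range J)" using lower by (intro bdd_belowI2)
  have m: "m \<le> J x" for x unfolding m_def by (rule cInf_lower[OF _ bdd]) simp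
  have "\<exists>x. J x < m + inverse (real (Suc n))" for n
  proof -
    have "\<exists>y\<in>range J. y < m + inverse (real (Suc n))"
      unfolding m_def by (rule cInf_lessD) simp_all
    then show ?thesis by blast
  qed
  then obtain X where X: "\<And>n. J (X n) < m + inverse (real (Suc n))" by metis
  have parallelogram: "(norm (x - y))\<^sup>2 = 2 * J x + 2 * J y - 4 * J ((1/2) *\<^sub>R (x + y))" for x y
  proof -
    have "(norm ((1/2) *\<^sub>R (x + y)))\<^sup>2 = (norm (x + y))\<^sup>2 / 4"
      by (simp add: power_divide)
    moreover have "f ((1/2) *\<^sub>R (x + y)) = (f x + f y) / 2"
      by (simp add: f.scaleR f.add)
    ultimately show ?thesis
      by (simp add: J_def power2_norm_eq_inner inner_add_left inner_add_right inner_diff_left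
          inner_diff_right inner_commute)
  qed
  have "Cauchy X"
  proof (rule CauchyI)
    fix e :: real assume "e > 0"
    then obtain N where N: "inverse (real (Suc N)) < e\<^sup>2 / 4"
      using reals_Archimedean[of "e\<^sup>2 / 4"] by auto
    have "norm (X i - X j) < e" if "i \<ge> N" "j \<ge> N" for i j
    proof -
      have "J (X k) < m + e\<^sup>2 / 4" if "k \<ge> N" for k
      proof -
        have "inverse (real (Suc k)) \<le> inverse (real (Suc N))" using that by (simp add: field_simps)
        then show ?thesis using X[of k] N by linarith
      qed
      from this[OF \<open>i \<ge> N\<close>] this[OF \<open>j \<ge> N\<close>]
      have "(norm (X i - X j))\<^sup>2 < e\<^sup>2"
        using m[of "(1/2) *\<^sub>R (X i + X j)"] unfolding parallelogram by linarith
      then show ?thesis by (rule power2_less_imp_less) (use \<open>e > 0\<close> in simp)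
    qed
    then show "\<exists>M. \<forall>i\<ge>M. \<forall>j\<ge>M. norm (X i - X j) < e" by blast
  qed
  then obtain z where z: "X \<longlonglongrightarrow> z" using Cauchy_convergent_iff convergent_def by blast
  have "(\<lambda>n. J (X n)) \<longlonglongrightarrow> J z"
    unfolding J_def by (intro tendsto_intros f.tendsto z)
  moreover have "(\<lambda>n. m + inverse (real (Suc n))) \<longlonglongrightarrow> m + 0"
    by (intro tendsto_intros LIMSEQ_inverse_real_of_nat)
  ultimately have "J z \<le> m + 0"
    by (rule LIMSEQ_le) (use X in \<open>auto intro: less_imp_le\<close>)
  then have minimal: "J z \<le> J x" for x using m[of x] by simp
  have "f v = inner v z" for v
  proof -
    define d where "d = inner v z - f v"
    have expand: "(norm (z + t *\<^sub>R v))\<^sup>2 = (norm z)\<^sup>2 + 2 * t * inner v z + t\<^sup>2 * (norm v)\<^sup>2" for t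
      unfolding power2_norm_eq_inner inner_add_left inner_add_right inner_scaleR_left
        inner_scaleR_right inner_commute[of z v] by (simp add: power2_eq_square algebra_simps)
    have pos: "0 \<le> 2 * t * d + t\<^sup>2 * (norm v)\<^sup>2" for t
    proof -
      have "J (z + t *\<^sub>R v) = J z + 2 * t * d + t\<^sup>2 * (norm v)\<^sup>2"
        by (simp add: J_def expand d_def f.add f.scaleR algebra_simps)
      then show ?thesis using minimal[of "z + t *\<^sub>R v"] by simp
    qed
    \<comment> \<open>The quadratic is least at \<open>t = - d / \<parallel>v\<parallel>\<^sup>2\<close>; adding \<open>1\<close> to the denominator covers \<open>v = 0\<close>.\<close>
    define N where "N = (norm v)\<^sup>2 + 1"
    have N: "N > 0" unfolding N_def by (rule add_nonneg_pos) simp_all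
    have "0 \<le> (2 * (- d / N) * d + (- d / N)\<^sup>2 * (norm v)\<^sup>2) * N\<^sup>2"
      using pos[of "- d / N"] by simp
    also have "\<dots> = - 2 * d\<^sup>2 * N + d\<^sup>2 * (norm v)\<^sup>2"
      using N by (simp add: field_simps power2_eq_square)
    also have "\<dots> = - (d\<^sup>2 * ((norm v)\<^sup>2 + 2))"
      by (simp add: N_def algebra_simps)
    finally have "d\<^sup>2 * ((norm v)\<^sup>2 + 2) \<le> 0" by simp
    moreover have "(norm v)\<^sup>2 + 2 > 0" by (rule add_nonneg_pos) simp_all
    ultimately have "d\<^sup>2 \<le> 0" by (simp add: mult_le_0_iff)
    then show ?thesis by (simp add: d_def)
  qed
  then show thesis by (rule that)
qed

lemma complex_eq_if_Re_eq_of_rotations: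
  fixes z w :: complex
  assumes "Re z = Re w" "Re (\<i> * z) = Re (\<i> * w)"
  shows "z = w"
  using assms by (simp add: complex_eq_iff)

lemma cinner_right_ext:
  fixes y z :: "'a::complex_inner"
  assumes "\<And>x. cinner x y = cinner x z"
  shows "y = z"
proof -
  have "cinner (y - z) (y - z) = 0" by (simp add: cinner_diff_right assms)
  then show ?thesis by (simp add: cinner_eq_zero_iff)
qed

text \<open>Apply Cauchy-Schwarz to \<open>\<parallel>Sy\<parallel>\<^sup>2 = \<langle>TSy, y\<rangle>\<close>.\<close>

lemma norm_adjoint_le:
  assumes T: "bounded_clinear T" and S: "\<And>x. cinner (T x) y = cinner x (S y)"
  shows "norm (S y) \<le> onorm T * norm y"
proof (cases "S y = 0")
  case True
  then show ?thesis by (simp add: onorm_pos_le bounded_clinear_bounded_linear[OF T])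
next
  case False
  have "(norm (S y))\<^sup>2 = cmod (cinner (T (S y)) y)"
    by (simp add: S cinner_self norm_power)
  also have "\<dots> \<le> norm (T (S y)) * norm y" by (rule cinner_Cauchy_Schwarz)
  also have "\<dots> \<le> (onorm T * norm (S y)) * norm y"
    by (intro mult_right_mono bounded_clinear_norm T) simp
  finally have "norm (S y) * norm (S y) \<le> norm (S y) * (onorm T * norm y)"
    by (simp add: power2_eq_square mult_ac)
  then show ?thesis using False by simp
qed

text \<open>
  The real functional \<open>x \<mapsto> Re \<langle>Tx, y\<rangle>\<close> is represented by a vector \<open>S y\<close>; replacing \<open>x\<close> by \<open>\<i> x\<close>
  shows that the imaginary parts agree too.
\<close>

lemma adjoint_exists:
  fixes T :: "'a::chilbert_space \<Rightarrow> 'b::chilbert_space"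
  assumes T: "bounded_clinear T"
  obtains S where "bounded_clinear S" "\<And>x y. cinner (T x) y = cinner x (S y)"
proof -
  have "\<exists>z. \<forall>x. cinner (T x) y = cinner x z" for y
  proof -
    have "bounded_linear (\<lambda>x. inner (T x) y)"
      by (intro bounded_linear_inner_left_comp bounded_clinear_bounded_linear T)
    then obtain z where z: "\<And>x. inner (T x) y = inner x z"
      by (rule Riesz_representation_real) blast
    have "cinner (T x) y = cinner x z" for x
      using z[of x] z[of "\<i> *\<^sub>C x"]
      unfolding inner_eq_Re_cinner bounded_clinear_scaleC[OF T] cinner_scaleC_left
      by (rule complex_eq_if_Re_eq_of_rotations)
    then show ?thesis by blast
  qed
  then obtain S where S: "\<And>x y. cinner (T x) y = cinner x (S y)" by metis
  have "bounded_clinear S"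
  proof (rule bounded_clinearI[where K = "onorm T"])
    show "S (x + y) = S x + S y" for x y
      by (rule cinner_right_ext) (simp add: S[symmetric] cinner_add_right)
    show "S (c *\<^sub>C x) = c *\<^sub>C S x" for c x
      by (rule cinner_right_ext) (simp add: S[symmetric] cinner_scaleC_right)
    show "norm (S y) \<le> onorm T * norm y" for y
      by (rule norm_adjoint_le[OF T S])
  qed
  then show thesis using that S by blast
qed

lemma cadjoint:
  fixes T :: "'a::chilbert_space \<Rightarrow> 'b::chilbert_space"
  assumes T: "bounded_clinear T"
  shows bounded_clinear_cadjoint: "bounded_clinear (T\<^sup>\<dagger>)"
    and cinner_cadjoint: "cinner (T x) y = cinner x (T\<^sup>\<dagger> y)"
proof -
  obtain S where S: "bounded_clinear S" "\<And>x y. cinner (T x) y = cinner x (S y)"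
    using adjoint_exists[OF T] by blast
  have "bounded_clinear (T\<^sup>\<dagger>) \<and> (\<forall>x y. cinner (T x) y = cinner x ((T\<^sup>\<dagger>) y))"
    unfolding cadjoint_def
  proof (rule theI[of _ S])
    show "bounded_clinear S \<and> (\<forall>x y. cinner (T x) y = cinner x (S y))" using S by blast
    show "R = S" if "bounded_clinear R \<and> (\<forall>x y. cinner (T x) y = cinner x (R y))" for R
    proof (rule ext, rule cinner_right_ext)
      fix x y show "cinner x (R y) = cinner x (S y)"
        using that by (simp flip: S(2))
    qed
  qed
  then show "bounded_clinear (T\<^sup>\<dagger>)" "cinner (T x) y = cinner x (T\<^sup>\<dagger> y)" by blast+
qed

lemma onorm_cadjoint_le:
  fixes T :: "'a::chilbert_space \<Rightarrow> 'b::chilbert_space"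
  assumes T: "bounded_clinear T"
  shows "onorm (T\<^sup>\<dagger>) \<le> onorm T"
  by (rule onorm_bound)
     (intro onorm_pos_le bounded_clinear_bounded_linear T,
      rule norm_adjoint_le[OF T cinner_cadjoint[OF T]])

section \<open>The universal property of the algebraic tensor product\<close>

definition free_lift :: "('p \<Rightarrow> 'c::complex_vector) \<Rightarrow> ('p \<Rightarrow>\<^sub>0 complex) \<Rightarrow> 'c"
  where "free_lift g f = (\<Sum>p\<in>Poly_Mapping.keys f. Poly_Mapping.lookup f p *\<^sub>C g p)"

lemma free_lift_superset:
  assumes "finite S" "Poly_Mapping.keys f \<subseteq> S"
  shows "free_lift g f = (\<Sum>p\<in>S. Poly_Mapping.lookup f p *\<^sub>C g p)"
  unfolding free_lift_def using assms by (intro sum.mono_neutral_left) (auto simp: in_keys_iff)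

lemma free_lift_add: "free_lift g (f + h) = free_lift g f + free_lift g h"
proof -
  let ?S = "Poly_Mapping.keys f \<union> Poly_Mapping.keys h"
  have "finite ?S" "Poly_Mapping.keys (f + h) \<subseteq> ?S"
    by (simp_all add: Poly_Mapping.keys_add)
  then show ?thesis
    by (simp add: free_lift_superset[of ?S] lookup_add sum.distrib scaleC_add_left)
qed

lemma free_lift_scaleC: "free_lift g (c *\<^sub>C f) = c *\<^sub>C free_lift g f"
proof -
  have "Poly_Mapping.keys (c *\<^sub>C f) \<subseteq> Poly_Mapping.keys f"
    by (auto simp: in_keys_iff scaleC_poly_mapping.rep_eq)
  then show ?thesis
    by (simp add: free_lift_superset[of "Poly_Mapping.keys f"] scaleC_poly_mapping.rep_eq
        scaleC_complex_def complex_vector.scale_sum_right scaleC_scaleC)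
qed

lemma free_lift_diff: "free_lift g (f - h) = free_lift g f - free_lift g h"
  using free_lift_add[of g "f - h" h] by simp

lemma free_lift_single: "free_lift g (Poly_Mapping.single p 1) = g p"
  by (simp add: free_lift_def scaleC_one)

text \<open>
  The linear extension of a bilinear map to the free vector space on pairs vanishes on the
  relations defining the tensor product, hence factors through the quotient.
\<close>

lemma algebraic_tensor_universal:
  fixes \<beta> :: "'a::complex_vector \<Rightarrow> 'b::complex_vector \<Rightarrow> 'c::complex_vector"
  assumes "\<And>x x' y. \<beta> (x + x') y = \<beta> x y + \<beta> x' y" "\<And>x y y'. \<beta> x (y + y') = \<beta> x y + \<beta> x y'"
    and "\<And>c x y. \<beta> (c *\<^sub>C x) y = c *\<^sub>C \<beta> x y" "\<And>c x y. \<beta> x (c *\<^sub>C y) = c *\<^sub>C \<beta> x y"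
  obtains F where "\<And>s t. F (s + t) = F s + F t" "\<And>c t. F (c *\<^sub>C t) = c *\<^sub>C F t"
    "\<And>x y. F (atensor x y) = \<beta> x y"
proof -
  define g where "g p = \<beta> (fst p) (snd p)" for p
  have relators: "free_lift g f = 0" if "f \<in> cspan tensor_relators" for f
  proof -
    have "csubspace {f. free_lift g f = 0}"
      by (rule complex_vector.subspaceI)
         (simp_all add: free_lift_add free_lift_scaleC, simp add: free_lift_def)
    moreover have "tensor_relators \<subseteq> {f. free_lift g f = 0}"
      by (auto elim!: tensor_relators.cases
          simp: free_lift_diff free_lift_scaleC free_lift_single g_def assms)
    ultimately have "cspan tensor_relators \<subseteq> {f. free_lift g f = 0}"
      by (intro complex_vector.span_minimal)
    then show ?thesis using that by blast
  qed
  define F where "F t = free_lift g (rep_algebraic_tensor t)" for t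
  have F_abs: "F (abs_algebraic_tensor f) = free_lift g f" for f
  proof -
    have "abs_algebraic_tensor (rep_algebraic_tensor (abs_algebraic_tensor f))
        = abs_algebraic_tensor f"
      by (rule Quotient_abs_rep[OF Quotient_algebraic_tensor])
    then have "rep_algebraic_tensor (abs_algebraic_tensor f) - f \<in> cspan tensor_relators"
      by (simp add: algebraic_tensor.abs_eq_iff)
    from relators[OF this] show ?thesis by (simp add: F_def free_lift_diff)
  qed
  have "F (s + t) = F s + F t" for s t
    by (induction s rule: algebraic_tensor.abs_induct, induction t rule: algebraic_tensor.abs_induct)
       (simp add: plus_algebraic_tensor.abs_eq F_abs free_lift_add)
  moreover have "F (c *\<^sub>C t) = c *\<^sub>C F t" for c t
    by (induction t rule: algebraic_tensor.abs_induct)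
       (simp add: scaleC_algebraic_tensor.abs_eq F_abs free_lift_scaleC)
  moreover have "F (atensor x y) = \<beta> x y" for x y
    by (simp add: atensor.abs_eq F_abs free_lift_single g_def)
  ultimately show thesis by (rule that)
qed

section \<open>Tensor operators on the algebraic tensor product\<close>

lemma norm_orthogonal_tensor_sum:
  assumes "finite E" and orth: "\<And>e e'. e \<in> E \<Longrightarrow> e' \<in> E \<Longrightarrow> e \<noteq> e' \<Longrightarrow> cinner e e' = 0"
  shows "(norm (\<Sum>e\<in>E. atensor (X e) e))\<^sup>2 = (\<Sum>e\<in>E. (norm (X e))\<^sup>2 * (norm e)\<^sup>2)"
proof -
  let ?t = "\<Sum>e\<in>E. atensor (X e) e"
  have "cinner ?t ?t = (\<Sum>e\<in>E. \<Sum>e'\<in>E. cinner (X e) (X e') * cinner e e')"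
    by (simp only: cinner_sum_left) (simp only: cinner_sum_right cinner_atensor)
  also have "\<dots> = (\<Sum>e\<in>E. \<Sum>e'\<in>E. if e' = e then cinner (X e) (X e) * cinner e e else 0)"
    using orth by (intro sum.cong refl) auto
  also have "\<dots> = complex_of_real (\<Sum>e\<in>E. (norm (X e))\<^sup>2 * (norm e)\<^sup>2)"
    using assms(1) by (simp add: cinner_self)
  finally show ?thesis by (simp only: cinner_self of_real_eq_iff)
qed

lemma additive_zero:
  fixes F :: "'a::group_add \<Rightarrow> 'b::group_add"
  assumes "\<And>s t. F (s + t) = F s + F t"
  shows "F 0 = 0"
proof -
  have "F 0 + F 0 = F 0 + 0" using assms[of 0 0] by simp
  then show ?thesis by (rule add_left_imp_eq)
qed

lemma additive_sum:
  fixes F :: "'a::ab_group_add \<Rightarrow> 'b::ab_group_add"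
  assumes "\<And>s t. F (s + t) = F s + F t"
  shows "F (sum f S) = (\<Sum>i\<in>S. F (f i))"
  by (induction S rule: infinite_finite_induct) (simp_all add: assms additive_zero[of F, OF assms])

text \<open>
  Writing \<open>t = \<Sum> x\<^sub>e \<otimes> e\<close> with orthogonal \<open>e\<close>, the map \<open>A \<otimes> 1\<close> changes only the coefficients
  \<open>x\<^sub>e\<close>, each by a factor of at most \<open>\<parallel>A\<parallel>\<close>.
\<close>

lemma algebraic_tensor_op_left:
  fixes A :: "'a::complex_inner \<Rightarrow> 'c::complex_inner"
  assumes A: "bounded_clinear A"
  obtains F :: "('a, 'b::complex_inner) algebraic_tensor \<Rightarrow> ('c, 'b) algebraic_tensor"
  where "\<And>s t. F (s + t) = F s + F t" "\<And>c t. F (c *\<^sub>C t) = c *\<^sub>C F t"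
    "\<And>x y. F (atensor x y) = atensor (A x) y" "\<And>t. norm (F t) \<le> onorm A * norm t"
proof -
  note A_simps = bounded_clinear_add[OF A] bounded_clinear_scaleC[OF A]
  obtain F :: "('a, 'b) algebraic_tensor \<Rightarrow> ('c, 'b) algebraic_tensor"
    where F: "\<And>s t. F (s + t) = F s + F t" "\<And>c t. F (c *\<^sub>C t) = c *\<^sub>C F t"
      "\<And>x y. F (atensor x y) = atensor (A x) y"
    by (rule algebraic_tensor_universal[of "\<lambda>x y. atensor (A x) y :: ('c, 'b) algebraic_tensor",
          OF _ _ _ _ that])
       (simp_all add: A_simps atensor_add_left atensor_add_right atensor_scaleC_left
          atensor_scaleC_right)
  have pos: "onorm A \<ge> 0" by (intro onorm_pos_le bounded_clinear_bounded_linear A)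
  have "norm (F t) \<le> onorm A * norm t" for t
  proof -
    obtain E X where E: "finite E"
      and orth: "\<And>e e'. e \<in> E \<Longrightarrow> e' \<in> E \<Longrightarrow> e \<noteq> e' \<Longrightarrow> cinner e e' = 0"
      and t: "t = (\<Sum>e\<in>E. atensor (X e) e)"
      using algebraic_tensor_orthogonal_form[of t] by blast
    have "(norm (F t))\<^sup>2 = (\<Sum>e\<in>E. (norm (A (X e)))\<^sup>2 * (norm e)\<^sup>2)"
      unfolding t additive_sum[of F, OF F(1)] F(3)
      by (rule norm_orthogonal_tensor_sum[OF E orth])
    also have "\<dots> \<le> (\<Sum>e\<in>E. (onorm A * norm (X e))\<^sup>2 * (norm e)\<^sup>2)"
      by (intro sum_mono mult_right_mono power_mono bounded_clinear_norm A) simp_all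
    also have "\<dots> = (onorm A)\<^sup>2 * (\<Sum>e\<in>E. (norm (X e))\<^sup>2 * (norm e)\<^sup>2)"
      by (simp add: sum_distrib_left power_mult_distrib mult_ac)
    also have "\<dots> = (onorm A * norm t)\<^sup>2"
      by (simp add: t power_mult_distrib norm_orthogonal_tensor_sum[OF E orth])
    finally show ?thesis by (rule power2_le_imp_le) (simp add: pos)
  qed
  with F show thesis by (rule that)
qed

lemma algebraic_tensor_swap:
  obtains F :: "('a::complex_inner, 'b::complex_inner) algebraic_tensor \<Rightarrow> ('b, 'a) algebraic_tensor"
  where "\<And>s t. F (s + t) = F s + F t" "\<And>c t. F (c *\<^sub>C t) = c *\<^sub>C F t"
    "\<And>x y. F (atensor x y) = atensor y x" "\<And>t. norm (F t) = norm t"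
proof -
  obtain F :: "('a, 'b) algebraic_tensor \<Rightarrow> ('b, 'a) algebraic_tensor"
    where F: "\<And>s t. F (s + t) = F s + F t" "\<And>c t. F (c *\<^sub>C t) = c *\<^sub>C F t"
      "\<And>x y. F (atensor x y) = atensor y x"
    by (rule algebraic_tensor_universal[of "\<lambda>x y. atensor y x :: ('b, 'a) algebraic_tensor",
          OF _ _ _ _ that])
       (simp_all add: atensor_add_left atensor_add_right atensor_scaleC_left atensor_scaleC_right)
  have F0: "F 0 = 0" by (rule additive_zero) (rule F(1))
  have "cinner (F s) (F t) = cinner s t" for s t
  proof (induction s rule: algebraic_tensor_induct)
    case (add s x y)
    have "cinner (F (atensor x y)) (F t) = cinner (atensor x y) t"
      by (induction t rule: algebraic_tensor_induct)
         (simp_all add: F F0 cinner_add_right cinner_atensor)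
    with add show ?case by (simp add: F(1) cinner_add_left)
  qed (simp add: F0)
  then have "norm (F t) = norm t" for t
    by (simp add: norm_eq_sqrt_inner inner_eq_Re_cinner)
  with F show thesis by (rule that)
qed

text \<open>The factor \<open>1 \<otimes> B\<close> of \<open>A \<otimes> B\<close> is \<open>B \<otimes> 1\<close> conjugated by exchanging the tensor factors.\<close>

lemma algebraic_tensor_op:
  fixes A :: "'a::complex_inner \<Rightarrow> 'c::complex_inner" and B :: "'b::complex_inner \<Rightarrow> 'd::complex_inner"
  assumes A: "bounded_clinear A" and B: "bounded_clinear B"
  obtains F :: "('a, 'b) algebraic_tensor \<Rightarrow> ('c, 'd) algebraic_tensor"
  where "\<And>s t. F (s + t) = F s + F t" "\<And>c t. F (c *\<^sub>C t) = c *\<^sub>C F t"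
    "\<And>x y. F (atensor x y) = atensor (A x) (B y)" "\<And>t. norm (F t) \<le> onorm A * onorm B * norm t"
proof -
  obtain F :: "('a, 'b) algebraic_tensor \<Rightarrow> ('c, 'b) algebraic_tensor"
    where F: "\<And>s t. F (s + t) = F s + F t" "\<And>c t. F (c *\<^sub>C t) = c *\<^sub>C F t"
      "\<And>x y. F (atensor x y) = atensor (A x) y" "\<And>t. norm (F t) \<le> onorm A * norm t"
    using algebraic_tensor_op_left[OF A] by blast
  obtain G :: "('b, 'c) algebraic_tensor \<Rightarrow> ('d, 'c) algebraic_tensor"
    where G: "\<And>s t. G (s + t) = G s + G t" "\<And>c t. G (c *\<^sub>C t) = c *\<^sub>C G t"
      "\<And>x y. G (atensor x y) = atensor (B x) y" "\<And>t. norm (G t) \<le> onorm B * norm t"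
    using algebraic_tensor_op_left[OF B] by blast
  obtain S :: "('c, 'b) algebraic_tensor \<Rightarrow> ('b, 'c) algebraic_tensor"
    where S: "\<And>s t. S (s + t) = S s + S t" "\<And>c t. S (c *\<^sub>C t) = c *\<^sub>C S t"
      "\<And>x y. S (atensor x y) = atensor y x" "\<And>t. norm (S t) = norm t"
    using algebraic_tensor_swap by blast
  obtain R :: "('d, 'c) algebraic_tensor \<Rightarrow> ('c, 'd) algebraic_tensor"
    where R: "\<And>s t. R (s + t) = R s + R t" "\<And>c t. R (c *\<^sub>C t) = c *\<^sub>C R t"
      "\<And>x y. R (atensor x y) = atensor y x" "\<And>t. norm (R t) = norm t"
    using algebraic_tensor_swap by blast
  have "norm (R (G (S (F t)))) \<le> onorm A * onorm B * norm t" for t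
  proof -
    have "norm (R (G (S (F t)))) \<le> onorm B * norm (F t)"
      using G(4)[of "S (F t)"] by (simp add: R(4) S(4))
    also have "\<dots> \<le> onorm B * (onorm A * norm t)"
      by (intro mult_left_mono F(4) onorm_pos_le bounded_clinear_bounded_linear B)
    finally show ?thesis by (simp add: mult_ac)
  qed
  then show thesis
    by (intro that[of "\<lambda>t. R (G (S (F t)))"]) (simp_all add: F(1-3) G(1-3) S(1-3) R(1-3))
qed

section \<open>Tensor operators on the Hilbert space tensor product\<close>

text \<open>Set \<open>G(x) = lim F(X\<^sub>n)\<close> for any Cauchy sequence \<open>X\<close> that represents \<open>x\<close>.\<close>

lemma completion_extension:
  fixes F :: "'a::complex_inner \<Rightarrow> 'b::chilbert_space"
  assumes F: "bounded_clinear F" and K: "\<And>x. norm (F x) \<le> K * norm x"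
  obtains G where "bounded_clinear G" "\<And>x. G (to_completion x) = F x"
    "\<And>x. norm (G x) \<le> K * norm x"
proof -
  interpret F: bounded_linear F by (rule bounded_clinear_bounded_linear[OF F])
  have "\<exists>X. Cauchy X \<and> x = abs_completion X" for x :: "'a completion"
    using completion_cases by blast
  then obtain R where R: "\<And>x :: 'a completion. Cauchy (R x)"
    "\<And>x :: 'a completion. x = abs_completion (R x)" by metis
  define G where "G x = lim (\<lambda>n. F (R x n))" for x
  have lim: "(\<lambda>n. F (X n)) \<longlonglongrightarrow> G (abs_completion X)" if X: "Cauchy X" for X
  proof -
    let ?R = "R (abs_completion X)"
    have "(\<lambda>n. F (?R n)) \<longlonglongrightarrow> G (abs_completion X)"
      unfolding G_def convergent_LIMSEQ_iff[symmetric] Cauchy_convergent_iff[symmetric]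
      by (rule F.Cauchy[OF R(1)])
    moreover have "(\<lambda>n. X n - ?R n) \<longlonglongrightarrow> 0"
      using R(2) completion_eq_iff[OF X R(1)] by blast
    then have "(\<lambda>n. F (X n - ?R n)) \<longlonglongrightarrow> 0" by (rule F.tendsto_zero)
    ultimately have "(\<lambda>n. F (X n - ?R n) + F (?R n)) \<longlonglongrightarrow> 0 + G (abs_completion X)"
      by (intro tendsto_add)
    then show ?thesis by (simp add: F.diff)
  qed
  have G_bound: "norm (G x) \<le> K * norm x" for x
  proof -
    have "(\<lambda>n. norm (F (R x n))) \<longlonglongrightarrow> norm (G (abs_completion (R x)))"
      by (intro tendsto_norm lim R)
    moreover have "(\<lambda>n. K * norm (to_completion (R x n))) \<longlonglongrightarrow> K * norm (abs_completion (R x))"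
      by (intro tendsto_intros to_completion_tendsto R)
    ultimately have "norm (G (abs_completion (R x))) \<le> K * norm (abs_completion (R x))"
      by (rule LIMSEQ_le) (simp add: norm_to_completion K)
    then show ?thesis using R(2) by metis
  qed
  have "bounded_clinear G"
  proof (rule bounded_clinearI[OF _ _ G_bound])
    show "G (x + y) = G x + G y" for x y
    proof -
      obtain X Y where X: "Cauchy X" "x = abs_completion X" and Y: "Cauchy Y" "y = abs_completion Y"
        using completion_cases by metis
      have "(\<lambda>n. F (X n + Y n)) \<longlonglongrightarrow> G x + G y"
        unfolding F.add X(2) Y(2) by (intro tendsto_add lim X Y)
      moreover have "(\<lambda>n. F (X n + Y n)) \<longlonglongrightarrow> G (x + y)"
        unfolding X(2) Y(2) abs_completion_add[OF X(1) Y(1)] by (intro lim Cauchy_add_seq X Y)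
      ultimately show ?thesis by (rule LIMSEQ_unique[symmetric])
    qed
    show "G (c *\<^sub>C x) = c *\<^sub>C G x" for c x
    proof -
      obtain X where X: "Cauchy X" "x = abs_completion X" using completion_cases by metis
      have "(\<lambda>n. F (c *\<^sub>C X n)) \<longlonglongrightarrow> c *\<^sub>C G x"
        unfolding bounded_clinear_scaleC[OF F] X(2)
        by (intro bounded_linear.tendsto[OF bounded_linear_scaleC] lim X)
      moreover have "(\<lambda>n. F (c *\<^sub>C X n)) \<longlonglongrightarrow> G (c *\<^sub>C x)"
        unfolding X(2) abs_completion_scaleC[OF X(1)] by (intro lim Cauchy_scaleC_seq X)
      ultimately show ?thesis by (rule LIMSEQ_unique[symmetric])
    qed
  qed
  moreover have "G (to_completion x) = F x" for x
    using lim[OF Cauchy_const_seq[of x]] by (simp add: to_completion_eq LIMSEQ_const_iff)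
  ultimately show thesis using G_bound by (rule that)
qed

text \<open>
  The set where two bounded operators agree is a closed subspace, and the elementary tensors span
  a dense one.
\<close>

lemma bounded_clinear_eqI_htensor:
  fixes S T :: "('a::complex_inner, 'b::complex_inner) hilbert_tensor \<Rightarrow> 'c::complex_inner"
  assumes S: "bounded_clinear S" and T: "bounded_clinear T"
    and eq: "\<And>x y. S (x \<otimes>\<^sub>H y) = T (x \<otimes>\<^sub>H y)"
  shows "S = T"
proof -
  interpret S: bounded_linear S by (rule bounded_clinear_bounded_linear[OF S])
  interpret T: bounded_linear T by (rule bounded_clinear_bounded_linear[OF T])
  let ?E = "{v. S v = T v}"
  have "csubspace ?E"
    by (rule complex_vector.subspaceI)
       (simp_all add: S.add T.add S.zero T.zero bounded_clinear_scaleC[OF S] bounded_clinear_scaleC[OF T])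
  then have "cspan {x \<otimes>\<^sub>H y | x y. True} \<subseteq> ?E"
    by (intro complex_vector.span_minimal) (auto simp: eq)
  moreover have "closed ?E"
    by (intro closed_Collect_eq S.continuous_on T.continuous_on continuous_on_id)
  ultimately have "closure (cspan {x \<otimes>\<^sub>H y | (x :: 'a) (y :: 'b). True}) \<subseteq> ?E"
    by (rule closure_minimal)
  then show ?thesis unfolding cspan_htensor_dense by auto
qed

lemma cinner_htensor_ext:
  fixes v w :: "('a::complex_inner, 'b::complex_inner) hilbert_tensor"
  assumes "\<And>x y. cinner (x \<otimes>\<^sub>H y) v = cinner (x \<otimes>\<^sub>H y) w"
  shows "v = w"
proof -
  have functional: "bounded_clinear (\<lambda>s. cinner s u)" for u :: "('a, 'b) hilbert_tensor"
    by (rule bounded_clinearI[where K = "norm u"])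
       (simp_all add: cinner_add_left cinner_scaleC_left scaleC_complex_def mult.commute[of "norm u"]
          cinner_Cauchy_Schwarz)
  have "(\<lambda>s. cinner s v) = (\<lambda>s. cinner s w)"
    by (rule bounded_clinear_eqI_htensor[OF functional functional assms])
  from fun_cong[OF this] show ?thesis by (rule cinner_right_ext)
qed

text \<open>
  The bounded extension \<open>G\<close> of the algebraic operator is the only candidate for the definite
  description that defines \<open>A \<otimes>\<^sub>o B\<close>.
\<close>

lemma htensor_op:
  fixes A :: "'a::complex_inner \<Rightarrow> 'c::complex_inner" and B :: "'b::complex_inner \<Rightarrow> 'd::complex_inner"
  assumes A: "bounded_clinear A" and B: "bounded_clinear B"
  shows bounded_clinear_htensor_op: "bounded_clinear (A \<otimes>\<^sub>o B)"
    and htensor_op_htensor: "(A \<otimes>\<^sub>o B) (x \<otimes>\<^sub>H y) = A x \<otimes>\<^sub>H B y"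
    and onorm_htensor_op_le: "onorm (A \<otimes>\<^sub>o B) \<le> onorm A * onorm B"
proof -
  obtain F :: "('a, 'b) algebraic_tensor \<Rightarrow> ('c, 'd) algebraic_tensor"
    where F: "\<And>s t. F (s + t) = F s + F t" "\<And>c t. F (c *\<^sub>C t) = c *\<^sub>C F t"
      "\<And>x y. F (atensor x y) = atensor (A x) (B y)" "\<And>t. norm (F t) \<le> onorm A * onorm B * norm t"
    using algebraic_tensor_op[OF A B] by blast
  have bound: "norm (to_completion (F t)) \<le> onorm A * onorm B * norm t" for t
    by (simp add: norm_to_completion F(4))
  have "bounded_clinear (\<lambda>t. to_completion (F t))"
    by (rule bounded_clinearI[OF _ _ bound])
       (simp_all add: F to_completion_add to_completion_scaleC)
  from completion_extension[OF this bound]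
  obtain G where G: "bounded_clinear G" "\<And>t. G (to_completion t) = to_completion (F t)"
    and G_bound: "\<And>v. norm (G v) \<le> onorm A * onorm B * norm v" by blast
  have G_htensor: "G (x \<otimes>\<^sub>H y) = A x \<otimes>\<^sub>H B y" for x y
    by (simp add: htensor_def G(2) F(3))
  have "A \<otimes>\<^sub>o B = G"
    unfolding htensor_op_def
  proof (rule the_equality)
    show "bounded_clinear G \<and> (\<forall>x y. G (x \<otimes>\<^sub>H y) = A x \<otimes>\<^sub>H B y)"
      using G(1) G_htensor by blast
    show "T = G" if "bounded_clinear T \<and> (\<forall>x y. T (x \<otimes>\<^sub>H y) = A x \<otimes>\<^sub>H B y)" for T
      using that G(1) by (intro bounded_clinear_eqI_htensor) (simp_all add: G_htensor)
  qed
  moreover have "onorm G \<le> onorm A * onorm B"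
    by (intro onorm_bound G_bound mult_nonneg_nonneg onorm_pos_le bounded_clinear_bounded_linear A B)
  ultimately show "bounded_clinear (A \<otimes>\<^sub>o B)" "(A \<otimes>\<^sub>o B) (x \<otimes>\<^sub>H y) = A x \<otimes>\<^sub>H B y"
    "onorm (A \<otimes>\<^sub>o B) \<le> onorm A * onorm B"
    using G(1) G_htensor by simp_all
qed

lemma htensor_op_compose:
  assumes "bounded_clinear A" "bounded_clinear B" "bounded_clinear C" "bounded_clinear D"
  shows "(A \<circ> C) \<otimes>\<^sub>o (B \<circ> D) = (A \<otimes>\<^sub>o B) \<circ> (C \<otimes>\<^sub>o D)"
  using assms
  by (intro bounded_clinear_eqI_htensor bounded_clinear_htensor_op bounded_clinear_compose)
     (simp_all add: htensor_op_htensor bounded_clinear_compose)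

lemma cadjoint_htensor_op:
  fixes A :: "'a::chilbert_space \<Rightarrow> 'c::chilbert_space" and B :: "'b::chilbert_space \<Rightarrow> 'd::chilbert_space"
  assumes A: "bounded_clinear A" and B: "bounded_clinear B"
  shows "(A \<otimes>\<^sub>o B)\<^sup>\<dagger> = A\<^sup>\<dagger> \<otimes>\<^sub>o B\<^sup>\<dagger>"
proof (rule bounded_clinear_eqI_htensor)
  note AB = bounded_clinear_htensor_op[OF A B]
  show "bounded_clinear ((A \<otimes>\<^sub>o B)\<^sup>\<dagger>)" by (rule bounded_clinear_cadjoint[OF AB])
  show "bounded_clinear (A\<^sup>\<dagger> \<otimes>\<^sub>o B\<^sup>\<dagger>)"
    by (intro bounded_clinear_htensor_op bounded_clinear_cadjoint A B)
  fix x y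
  show "((A \<otimes>\<^sub>o B)\<^sup>\<dagger>) (x \<otimes>\<^sub>H y) = (A\<^sup>\<dagger> \<otimes>\<^sub>o B\<^sup>\<dagger>) (x \<otimes>\<^sub>H y)"
    by (rule cinner_htensor_ext)
       (simp add: cinner_cadjoint[OF AB, symmetric] htensor_op_htensor bounded_clinear_cadjoint A B
          cinner_htensor cinner_cadjoint[OF A] cinner_cadjoint[OF B])
qed

section \<open>The numerical radius\<close>

text \<open>If the space is trivial, the numerical radius is \<open>0\<close>, hence the assumption \<open>0 \<le> c\<close>.\<close>

lemma numerical_radius_power2_le:
  assumes "\<And>x. norm x = 1 \<Longrightarrow> (cmod (cinner (T x) x))\<^sup>2 \<le> c" and "0 \<le> c"
  shows "(numerical_radius T)\<^sup>2 \<le> c"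
proof -
  let ?W = "insert 0 {cmod (cinner (T x) x) | x. norm x = 1}"
  have W: "r \<le> sqrt c" if "r \<in> ?W" for r
    using that assms by (auto intro: real_le_rsqrt)
  have "Sup ?W \<le> sqrt c" by (rule cSup_least) (use W in auto)
  moreover have "0 \<le> Sup ?W"
    by (rule cSup_upper) (use W in \<open>auto intro!: bdd_aboveI[of _ "sqrt c"]\<close>)
  ultimately have "(Sup ?W)\<^sup>2 \<le> (sqrt c)\<^sup>2" by (intro power_mono)
  then show ?thesis using \<open>0 \<le> c\<close> by (simp add: numerical_radius_def)
qed

lemma bounded_linear_adjoint_sum:
  fixes T :: "'a::chilbert_space \<Rightarrow> 'a"
  assumes T: "bounded_clinear T"
  shows "bounded_linear (\<lambda>v. T\<^sup>\<dagger> (T v) + T (T\<^sup>\<dagger> v))"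
  by (intro bounded_linear_add bounded_linear_compose[of "T\<^sup>\<dagger>" T] bounded_linear_compose[of T "T\<^sup>\<dagger>"]
      bounded_clinear_bounded_linear T bounded_clinear_cadjoint)

text \<open>
  Both \<open>\<parallel>Tx\<parallel>\<close> and \<open>\<parallel>T\<^sup>\<dagger>x\<parallel>\<close> dominate \<open>|\<langle>Tx, x\<rangle>|\<close>, and the sum of their squares is
  \<open>\<langle>(T\<^sup>\<dagger>T + TT\<^sup>\<dagger>)x, x\<rangle>\<close>.
\<close>

lemma numerical_radius_power2_le_onorm:
  fixes T :: "'a::chilbert_space \<Rightarrow> 'a"
  assumes T: "bounded_clinear T"
  shows "(numerical_radius T)\<^sup>2 \<le> 1 / 2 * onorm (\<lambda>v. T\<^sup>\<dagger> (T v) + T (T\<^sup>\<dagger> v))"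
proof (rule numerical_radius_power2_le)
  let ?S = "\<lambda>v. T\<^sup>\<dagger> (T v) + T (T\<^sup>\<dagger> v)"
  note S = bounded_linear_adjoint_sum[OF T]
  show "0 \<le> 1 / 2 * onorm ?S" using onorm_pos_le[OF S] by simp
  fix x :: 'a assume x: "norm x = 1"
  have "cmod (cinner (T x) x) \<le> norm (T x)"
    using cinner_Cauchy_Schwarz[of "T x" x] x by simp
  moreover have "cmod (cinner (T x) x) \<le> norm (T\<^sup>\<dagger> x)"
    using cinner_Cauchy_Schwarz[of x "T\<^sup>\<dagger> x"] x by (simp add: cinner_cadjoint[OF T])
  ultimately have sum_le: "2 * (cmod (cinner (T x) x))\<^sup>2 \<le> (norm (T x))\<^sup>2 + (norm (T\<^sup>\<dagger> x))\<^sup>2"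
    by (smt (verit) norm_ge_zero power_mono)
  have Tx: "(norm (T x))\<^sup>2 = Re (cinner x (T\<^sup>\<dagger> (T x)))"
    unfolding cinner_cadjoint[OF T, symmetric] by (simp add: cinner_self)
  have T'x: "(norm (T\<^sup>\<dagger> x))\<^sup>2 = Re (cinner x (T (T\<^sup>\<dagger> x)))"
    unfolding cinner_commute[of x] cinner_cadjoint[OF T] by (simp add: cinner_self)
  note sum_le
  also have "(norm (T x))\<^sup>2 + (norm (T\<^sup>\<dagger> x))\<^sup>2 = Re (cinner x (?S x))"
    unfolding cinner_add_right plus_complex.sel Tx T'x ..
  also have "\<dots> \<le> norm x * norm (?S x)"
    unfolding inner_eq_Re_cinner[symmetric] by (rule norm_cauchy_schwarz)
  also have "\<dots> \<le> onorm ?S" using onorm[OF S, of x] x by simp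
  finally show "(cmod (cinner (T x) x))\<^sup>2 \<le> 1 / 2 * onorm ?S" by simp
qed

lemma onorm_adjoint_sum_le:
  fixes T :: "'a::chilbert_space \<Rightarrow> 'a"
  assumes T: "bounded_clinear T"
  shows "1 / 2 * onorm (\<lambda>v. T\<^sup>\<dagger> (T v) + T (T\<^sup>\<dagger> v)) \<le> (onorm T)\<^sup>2"
proof -
  note T' = bounded_clinear_cadjoint[OF T]
  note bl = bounded_clinear_bounded_linear[OF T] bounded_clinear_bounded_linear[OF T']
  have prod: "onorm (T\<^sup>\<dagger>) * onorm T \<le> (onorm T)\<^sup>2"
    unfolding power2_eq_square
    by (intro mult_right_mono onorm_cadjoint_le T onorm_pos_le bl)
  have "onorm (\<lambda>v. T\<^sup>\<dagger> (T v) + T (T\<^sup>\<dagger> v)) \<le> onorm (T\<^sup>\<dagger> \<circ> T) + onorm (T \<circ> T\<^sup>\<dagger>)"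
    unfolding o_def by (intro onorm_triangle bounded_linear_compose[OF bl(2) bl(1)]
        bounded_linear_compose[OF bl(1) bl(2)])
  also have "\<dots> \<le> onorm (T\<^sup>\<dagger>) * onorm T + onorm T * onorm (T\<^sup>\<dagger>)"
    by (intro add_mono onorm_compose bl)
  finally show ?thesis using prod by (simp add: mult.commute[of "onorm T"])
qed

theorem theorem2p7:
  fixes A :: "'h::chilbert_space \<Rightarrow> 'h" and B :: "'k::chilbert_space \<Rightarrow> 'k"
  assumes "bounded_clinear A" and "bounded_clinear B"
  shows "(numerical_radius (A \<otimes>\<^sub>o B))\<^sup>2
        \<le> 1 / 2 * onorm (\<lambda>v. ((A\<^sup>\<dagger> \<circ> A) \<otimes>\<^sub>o (B\<^sup>\<dagger> \<circ> B)) v + ((A \<circ> A\<^sup>\<dagger>) \<otimes>\<^sub>o (B \<circ> B\<^sup>\<dagger>)) v)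
      \<and> 1 / 2 * onorm (\<lambda>v. ((A\<^sup>\<dagger> \<circ> A) \<otimes>\<^sub>o (B\<^sup>\<dagger> \<circ> B)) v + ((A \<circ> A\<^sup>\<dagger>) \<otimes>\<^sub>o (B \<circ> B\<^sup>\<dagger>)) v)
        \<le> (onorm A)\<^sup>2 * (onorm B)\<^sup>2"
proof -
  let ?T = "A \<otimes>\<^sub>o B"
  note A = assms(1) and B = assms(2)
  note adj = bounded_clinear_cadjoint[OF A] bounded_clinear_cadjoint[OF B]
  have T: "bounded_clinear ?T" by (rule bounded_clinear_htensor_op[OF A B])
  have S: "(\<lambda>v. ((A\<^sup>\<dagger> \<circ> A) \<otimes>\<^sub>o (B\<^sup>\<dagger> \<circ> B)) v + ((A \<circ> A\<^sup>\<dagger>) \<otimes>\<^sub>o (B \<circ> B\<^sup>\<dagger>)) v)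
      = (\<lambda>v. ?T\<^sup>\<dagger> (?T v) + ?T (?T\<^sup>\<dagger> v))"
    unfolding cadjoint_htensor_op[OF A B]
      htensor_op_compose[OF adj(1) adj(2) A B] htensor_op_compose[OF A B adj(1) adj(2)] o_apply ..
  have "(onorm ?T)\<^sup>2 \<le> (onorm A * onorm B)\<^sup>2"
    by (intro power_mono onorm_htensor_op_le A B onorm_pos_le bounded_clinear_bounded_linear T)
  then show ?thesis
    unfolding S using numerical_radius_power2_le_onorm[OF T] onorm_adjoint_sum_le[OF T]
    by (simp add: power_mult_distrib)
qed

end
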